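(* Let $G$ be a finitely generated group acting $3$-discontinuously and $2$-cocompactly on a compactum $T$ with $|T|>2$. Let $f_0(n)=\lambda^n$ ($\lambda\in\,]0,1[$) be the exponential function associated with this action as in the context. Let $f$ be a Floyd function with $f\ge f_0$, and let $F:\partial_f G\to T$ be the Floyd map. Then for every parabolic point $p\in T$, $$F^{-1}(p)=\partial(\mathrm{Stab}_G\,p),$$ where $\partial(\mathrm{Stab}_G\,p)$ is the topological boundary of the subset $\mathrm{Stab}_G\,p\subset G$ in the Floyd completion $\overline G_f$. Furthermore, if $a,b\in\partial_fG$ and $p\in T$ satisfy $F(a)=F(b)=p$, then either $a=b$ or $p$ is parabolic.
   Context: A compactum is a compact Hausdorff space. $\Theta^nT$ is the space of $n$-element subsets of $T$ with the topology coming from $T^n$. An action of a discrete group $G$ on $T$ by homeomorphisms is $3$-discontinuous if the induced action on $\Theta^3T$ is properly discontinuous ($\{g: gK\cap L\ne\emptyset\}$ is finite for all compact $K,L\subset\Theta^3T$). It is $2$-cocompact if $\Theta^2T/G$ is compact. The limit set $\Lambda(G)$ is the complement in $T$ of the set of points at which $G$ acts properly discontinuously. A point $p\in T$ is parabolic if $|\Lambda(\mathrm{Stab}_G\,p)|=1$, where $\mathrm{Stab}_G\,p$ is the stabilizer. Floyd function: $f:\mathbb Z_{>0}\to\mathbb R_{>0}$ (with $f(0):=f(1)$) such that for some $K>0$, $1\le f(n)/f(n+1)\le K$ for all $n$, and $\sum_n f(n)<\infty$. For a locally finite connected graph $\Gamma$ with base vertex $v$ and path distance $d$, the Floyd length of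 an edge $\{x,y\}$ is $f(d(v,\{x,y\}))$, the Floyd length of a path is the sum over its edges, and the Floyd distance $\delta_v$ between vertices is the infimum of Floyd lengths of paths joining them. The Floyd completion $\overline\Gamma_f$ is the Cauchy completion of $(\Gamma^0,\delta_v)$; it is compact and independent of $v$. The Floyd boundary is $\partial_f\Gamma=\overline\Gamma_f\setminus\Gamma^0$. For a finitely generated group $G$, $\overline G_f=G\sqcup\partial_fG$ is the Floyd completion of its Cayley graph with respect to a fixed finite generating set; left multiplication extends to an action of $G$ on $\overline G_f$ by homeomorphisms, and $G$ is an open discrete subset of $\overline G_f$. The function $f_0$ and the Floyd map: by a known theorem of Gerasimov, for an action as in the claim there are $\lambda\in\,]0,1[$ and a continuous $G$-equivariant map $F_0:\partial_{f_0}G\to T$, $f_0(n)=\lambda^n$, obtained as follows. There is a locally finite connected graph $\mathcal G$ on which $G$ acts with finitely many orbits of vertices and edges, and a compact Hausdorff topology on $M=T\sqcup\mathcal G^0$ inducing the given topology on $T$ and the discrete topology on the set of vertices $\mathcal G^0$, such that $G$ acts $3$-discontinuously on $M$. A $G$-equivariant quasi-isometric map $\psi:G\to\mathcal G^0$ extends to a continuous $G$-equivariant map $\overline G_{f_0}\to M$ whose restriction to $\partial_{f_0}G$ is $F_0$. Such $\lambda$ and $F_0$ are fixed. For a Floyd function $f\ge f_0$, the identity of $G$ extends to a continuous $G$-equivariant map $\chi:\partial_fG\to\partial_{f_0}G$, and $F:=F_0\circ\chi:\partial_fG\to T$ is called the Floyd map. *)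

theory Defs
  imports "HOL-Analysis.Analysis" "HOL-Algebra.Group_Action" "HOL-Algebra.Generated_Groups"
begin

section \<open>Quotient topology and spaces of subsets\<close>

definition quotient_topology :: "'a topology \<Rightarrow> ('a \<Rightarrow> 'b) \<Rightarrow> 'b topology" where
  "quotient_topology X q =
     topology (\<lambda>U. U \<subseteq> q ` topspace X \<and> openin X {x \<in> topspace X. q x \<in> U})"

lemma openin_quotient_topology:
  "openin (quotient_topology X q) U \<longleftrightarrow>
     U \<subseteq> q ` topspace X \<and> openin X {x \<in> topspace X. q x \<in> U}"
proof -
  have "istopology (\<lambda>U. U \<subseteq> q ` topspace X \<and> openin X {x \<in> topspace X. q x \<in> U})"
    unfolding istopology_def
  proof (intro conjI allI impI)
    fix U V
    assume U: "U \<subseteq> q ` topspace X \<and> openin X {x \<in> topspace X. q x \<in> U}"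
       and V: "V \<subseteq> q ` topspace X \<and> openin X {x \<in> topspace X. q x \<in> V}"
    have "{x \<in> topspace X. q x \<in> U \<inter> V} =
          {x \<in> topspace X. q x \<in> U} \<inter> {x \<in> topspace X. q x \<in> V}" by auto
    with U V show "openin X {x \<in> topspace X. q x \<in> U \<inter> V}" by auto
    show "U \<inter> V \<subseteq> q ` topspace X" using U by blast
  next
    fix \<K> assume K: "\<forall>K\<in>\<K>. K \<subseteq> q ` topspace X \<and> openin X {x \<in> topspace X. q x \<in> K}"
    have "{x \<in> topspace X. q x \<in> \<Union>\<K>} = (\<Union>K\<in>\<K>. {x \<in> topspace X. q x \<in> K})" by auto
    with K show "openin X {x \<in> topspace X. q x \<in> \<Union>\<K>}" by auto
    show "\<Union>\<K> \<subseteq> q ` topspace X" using K by blast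
  qed
  then show ?thesis by (simp add: quotient_topology_def topology_inverse')
qed

lemma topspace_quotient_topology: "topspace (quotient_topology X q) = q ` topspace X"
proof
  show "topspace (quotient_topology X q) \<subseteq> q ` topspace X"
    using openin_topspace[of "quotient_topology X q"] unfolding openin_quotient_topology by blast
  have "{x \<in> topspace X. q x \<in> q ` topspace X} = topspace X" by auto
  then have "openin (quotient_topology X q) (q ` topspace X)"
    by (simp add: openin_quotient_topology)
  then show "q ` topspace X \<subseteq> topspace (quotient_topology X q)"
    by (rule openin_subset)
qed

lemma quotient_map_quotient_topology: "quotient_map X (quotient_topology X q) q"
  unfolding quotient_map_def
  by (auto simp: topspace_quotient_topology openin_quotient_topology)

definition theta :: "nat \<Rightarrow> 'a topology \<Rightarrow> 'a set topology" where
  "theta n X =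
     quotient_topology
       (subtopology (product_topology (\<lambda>_. X) {..<n}) {x. inj_on x {..<n}})
       (\<lambda>x. x ` {..<n})"

lemma topspace_theta:
  "topspace (theta n X) = {A. A \<subseteq> topspace X \<and> finite A \<and> card A = n}"
proof (intro Set.set_eqI iffI)
  fix A assume "A \<in> topspace (theta n X)"
  then obtain x where x: "x \<in> (\<Pi>\<^sub>E i\<in>{..<n}. topspace X)" "inj_on x {..<n}" "A = x ` {..<n}"
    by (auto simp: theta_def topspace_quotient_topology)
  then show "A \<in> {A. A \<subseteq> topspace X \<and> finite A \<and> card A = n}"
    by (auto simp: card_image PiE_iff)
next
  fix A assume "A \<in> {A. A \<subseteq> topspace X \<and> finite A \<and> card A = n}"
  then have A: "A \<subseteq> topspace X" "finite A" "card A = n" by auto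
  then obtain h where h: "bij_betw h {..<n} A"
    using ex_bij_betw_nat_finite[of A] by (auto simp: atLeast0LessThan)
  let ?x = "restrict h {..<n}"
  have "inj_on ?x {..<n}" "?x ` {..<n} = A" 
    using h by (auto simp: bij_betw_def inj_on_restrict_eq)
  moreover have "?x \<in> (\<Pi>\<^sub>E i\<in>{..<n}. topspace X)"
    using h A by (auto simp: bij_betw_def)
  ultimately show "A \<in> topspace (theta n X)"
    unfolding theta_def topspace_quotient_topology
    by (intro image_eqI[of _ _ ?x]) simp_all
qed


section \<open>Group actions on spaces\<close>

definition acts_by_homeos :: "('g, 'm) monoid_scheme \<Rightarrow> 'a topology \<Rightarrow> ('g \<Rightarrow> 'a \<Rightarrow> 'a) \<Rightarrow> bool" where
  "acts_by_homeos G X \<phi> \<longleftrightarrow>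
     group_action G (topspace X) \<phi> \<and> (\<forall>g\<in>carrier G. homeomorphic_map X X (\<phi> g))"

definition properly_discontinuous ::
    "('g, 'm) monoid_scheme \<Rightarrow> 'a topology \<Rightarrow> ('g \<Rightarrow> 'a \<Rightarrow> 'a) \<Rightarrow> bool" where
  "properly_discontinuous G X \<phi> \<longleftrightarrow>
     (\<forall>K L. compactin X K \<and> compactin X L \<longrightarrow> finite {g \<in> carrier G. \<phi> g ` K \<inter> L \<noteq> {}})"

definition three_discontinuous ::
    "('g, 'm) monoid_scheme \<Rightarrow> 'a topology \<Rightarrow> ('g \<Rightarrow> 'a \<Rightarrow> 'a) \<Rightarrow> bool" where
  "three_discontinuous G X \<phi> \<longleftrightarrow> properly_discontinuous G (theta 3 X) (\<lambda>g A. \<phi> g ` A)"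

definition two_cocompact ::
    "('g, 'm) monoid_scheme \<Rightarrow> 'a topology \<Rightarrow> ('g \<Rightarrow> 'a \<Rightarrow> 'a) \<Rightarrow> bool" where
  "two_cocompact G X \<phi> \<longleftrightarrow>
     compact_space (quotient_topology (theta 2 X) (orbit G (\<lambda>g A. \<phi> g ` A)))"

text \<open>The limit set of a set \<open>H\<close> of group elements (a subgroup in all uses), acting through the
  restriction of \<open>\<phi>\<close>.\<close>

definition properly_discontinuous_at ::
    "'g set \<Rightarrow> 'a topology \<Rightarrow> ('g \<Rightarrow> 'a \<Rightarrow> 'a) \<Rightarrow> 'a \<Rightarrow> bool" where
  "properly_discontinuous_at H X \<phi> x \<longleftrightarrow>
     (\<exists>U. openin X U \<and> x \<in> U \<and> finite {h \<in> H. \<phi> h ` U \<inter> U \<noteq> {}})"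

definition limit_set :: "'g set \<Rightarrow> 'a topology \<Rightarrow> ('g \<Rightarrow> 'a \<Rightarrow> 'a) \<Rightarrow> 'a set" where
  "limit_set H X \<phi> = topspace X - {x \<in> topspace X. properly_discontinuous_at H X \<phi> x}"

definition parabolic_point ::
    "('g, 'm) monoid_scheme \<Rightarrow> 'a topology \<Rightarrow> ('g \<Rightarrow> 'a \<Rightarrow> 'a) \<Rightarrow> 'a \<Rightarrow> bool" where
  "parabolic_point G X \<phi> p \<longleftrightarrow>
     p \<in> topspace X \<and> card (limit_set (stabilizer G \<phi> p) X \<phi>) = 1"


section \<open>Cauchy completion of a metric space\<close>

definition cauchy_equiv :: "'a set \<Rightarrow> ('a \<Rightarrow> 'a \<Rightarrow> real) \<Rightarrow> ((nat \<Rightarrow> 'a) \<times> (nat \<Rightarrow> 'a)) set" where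
  "cauchy_equiv M d =
     {(s, t). Metric_space.MCauchy M d s \<and> Metric_space.MCauchy M d t \<and>
              (\<lambda>n. d (s n) (t n)) \<longlonglongrightarrow> 0}"

definition cauchy_completion :: "'a set \<Rightarrow> ('a \<Rightarrow> 'a \<Rightarrow> real) \<Rightarrow> (nat \<Rightarrow> 'a) set set" where
  "cauchy_completion M d = {s. Metric_space.MCauchy M d s} // cauchy_equiv M d"

text \<open>The locale \<^locale>\<open>Metric_space\<close> demands nonnegativity and symmetry also off the carrier, whence
  the value \<open>0\<close> there.\<close>

definition completion_dist ::
    "'a set \<Rightarrow> ('a \<Rightarrow> 'a \<Rightarrow> real) \<Rightarrow> (nat \<Rightarrow> 'a) set \<Rightarrow> (nat \<Rightarrow> 'a) set \<Rightarrow> real" where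
  "completion_dist M d \<xi> \<eta> =
     (if \<xi> \<in> cauchy_completion M d \<and> \<eta> \<in> cauchy_completion M d
      then THE r. \<forall>s\<in>\<xi>. \<forall>t\<in>\<eta>. (\<lambda>n. d (s n) (t n)) \<longlonglongrightarrow> r
      else 0)"

definition completion_topology ::
    "'a set \<Rightarrow> ('a \<Rightarrow> 'a \<Rightarrow> real) \<Rightarrow> (nat \<Rightarrow> 'a) set topology" where
  "completion_topology M d = Metric_space.mtopology (cauchy_completion M d) (completion_dist M d)"

definition completion_embed ::
    "'a set \<Rightarrow> ('a \<Rightarrow> 'a \<Rightarrow> real) \<Rightarrow> 'a \<Rightarrow> (nat \<Rightarrow> 'a) set" where
  "completion_embed M d x = cauchy_equiv M d `` {\<lambda>_. x}"

context Metric_space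
begin

lemma convergent_dist_Cauchy:
  assumes s: "MCauchy s" and t: "MCauchy t"
  shows "convergent (\<lambda>n. d (s n) (t n))"
proof -
  have sM: "s n \<in> M" and tM: "t n \<in> M" for n using s t by (auto simp: MCauchy_def)
  have "Cauchy (\<lambda>n. d (s n) (t n))"
  proof (rule metric_CauchyI)
    fix e :: real assume "e > 0"
    then have "e/2 > 0" by simp
    then obtain N1 N2 where N1: "\<And>n n'. \<lbrakk>N1 \<le> n; N1 \<le> n'\<rbrakk> \<Longrightarrow> d (s n) (s n') < e/2"
      and N2: "\<And>n n'. \<lbrakk>N2 \<le> n; N2 \<le> n'\<rbrakk> \<Longrightarrow> d (t n) (t n') < e/2"
      using s t unfolding MCauchy_def by meson
    have "dist (d (s m) (t m)) (d (s n) (t n)) < e" if "m \<ge> max N1 N2" "n \<ge> max N1 N2" for m n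
    proof -
      have "d (s m) (t m) \<le> d (s m) (s n) + d (s n) (t n) + d (t n) (t m)"
        using triangle[OF sM[of m] sM[of n] tM[of m]] triangle[OF sM[of n] tM[of n] tM[of m]] by simp
      moreover have "d (s n) (t n) \<le> d (s n) (s m) + d (s m) (t m) + d (t m) (t n)"
        using triangle[OF sM[of n] sM[of m] tM[of n]] triangle[OF sM[of m] tM[of m] tM[of n]] by simp
      moreover have "d (s m) (s n) < e/2" "d (s n) (s m) < e/2" "d (t m) (t n) < e/2" "d (t n) (t m) < e/2"
        using that N1[of m n] N1[of n m] N2[of m n] N2[of n m] by auto
      ultimately show ?thesis unfolding dist_real_def by linarith
    qed
    then show "\<exists>K. \<forall>m\<ge>K. \<forall>n\<ge>K. dist (d (s m) (t m)) (d (s n) (t n)) < e" by blast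
  qed
  then show ?thesis by (rule Cauchy_convergent)
qed

lemma equiv_cauchy_equiv: "equiv {s. MCauchy s} (cauchy_equiv M d)"
proof (rule equivI)
  show "cauchy_equiv M d \<subseteq> {s. MCauchy s} \<times> {s. MCauchy s}"
    by (auto simp: cauchy_equiv_def)
  show "refl_on {s. MCauchy s} (cauchy_equiv M d)"
    unfolding refl_on_def cauchy_equiv_def by (auto simp: MCauchy_def subset_iff)
  show "sym (cauchy_equiv M d)"
    unfolding sym_def cauchy_equiv_def by (simp add: commute)
  show "trans (cauchy_equiv M d)"
  proof (rule transI)
    fix s t u assume st: "(s, t) \<in> cauchy_equiv M d" and tu: "(t, u) \<in> cauchy_equiv M d"
    then have C: "MCauchy s" "MCauchy t" "MCauchy u" by (auto simp: cauchy_equiv_def)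
    have "(\<lambda>n. d (s n) (t n) + d (t n) (u n)) \<longlonglongrightarrow> 0 + 0"
      using st tu by (intro tendsto_add) (auto simp: cauchy_equiv_def)
    then have "(\<lambda>n. d (s n) (u n)) \<longlonglongrightarrow> 0"
    proof -
      assume lim: "(\<lambda>n. d (s n) (t n) + d (t n) (u n)) \<longlonglongrightarrow> 0 + 0"
      have "d (s n) (u n) \<le> d (s n) (t n) + d (t n) (u n)" for n
        using C by (intro triangle) (auto simp: MCauchy_def)
      then show ?thesis
        by (intro tendsto_sandwich[OF always_eventually always_eventually tendsto_const lim[simplified]])
           simp_all
    qed
    then show "(s, u) \<in> cauchy_equiv M d" using C by (simp add: cauchy_equiv_def)
  qed
qed

lemma completion_dist_tendsto:
  assumes \<xi>: "\<xi> \<in> cauchy_completion M d" and \<eta>: "\<eta> \<in> cauchy_completion M d"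
    and "s \<in> \<xi>" "t \<in> \<eta>"
  shows "(\<lambda>n. d (s n) (t n)) \<longlonglongrightarrow> completion_dist M d \<xi> \<eta>"
proof -
  have mem: "(a, b) \<in> cauchy_equiv M d" 
    if "\<zeta> \<in> cauchy_completion M d" "a \<in> \<zeta>" "b \<in> \<zeta>" for \<zeta> a b
    using that quotient_eq_iff[OF equiv_cauchy_equiv] unfolding cauchy_completion_def by blast
  have C: "MCauchy s" "MCauchy t"
    using mem[OF \<xi> \<open>s \<in> \<xi>\<close> \<open>s \<in> \<xi>\<close>] mem[OF \<eta> \<open>t \<in> \<eta>\<close> \<open>t \<in> \<eta>\<close>] by (auto simp: cauchy_equiv_def)
  then obtain r where r: "(\<lambda>n. d (s n) (t n)) \<longlonglongrightarrow> r"
    using convergent_dist_Cauchy by (auto simp: convergent_def)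
  have all: "\<forall>s'\<in>\<xi>. \<forall>t'\<in>\<eta>. (\<lambda>n. d (s' n) (t' n)) \<longlonglongrightarrow> r"
  proof (intro ballI)
    fix s' t' assume "s' \<in> \<xi>" "t' \<in> \<eta>"
    then have s': "(s, s') \<in> cauchy_equiv M d" and t': "(t, t') \<in> cauchy_equiv M d"
      using mem[OF \<xi> \<open>s \<in> \<xi>\<close>] mem[OF \<eta> \<open>t \<in> \<eta>\<close>] by auto
    have M: "s n \<in> M" "t n \<in> M" "s' n \<in> M" "t' n \<in> M" for n
      using s' t' by (auto simp: cauchy_equiv_def MCauchy_def)
    have lim: "(\<lambda>n. d (s n) (s' n) + d (t n) (t' n)) \<longlonglongrightarrow> 0 + 0"
      using s' t' by (intro tendsto_add) (auto simp: cauchy_equiv_def)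
    have "\<bar>d (s' n) (t' n) - d (s n) (t n)\<bar> \<le> d (s n) (s' n) + d (t n) (t' n)" for n
      using triangle[OF M(3)[of n] M(1)[of n] M(4)[of n]] triangle[OF M(1)[of n] M(2)[of n] M(4)[of n]]
        triangle[OF M(1)[of n] M(3)[of n] M(2)[of n]] triangle[OF M(3)[of n] M(4)[of n] M(2)[of n]]
        commute[of "s n" "s' n"] commute[of "t n" "t' n"] by linarith
    then have "(\<lambda>n. d (s' n) (t' n) - d (s n) (t n)) \<longlonglongrightarrow> 0"
      by (intro Lim_null_comparison[OF always_eventually lim[simplified]]) simp
    from tendsto_add[OF this r] show "(\<lambda>n. d (s' n) (t' n)) \<longlonglongrightarrow> r" by simp
  qed
  have "completion_dist M d \<xi> \<eta> = r"
  proof -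
    have "(THE r. \<forall>s\<in>\<xi>. \<forall>t\<in>\<eta>. (\<lambda>n. d (s n) (t n)) \<longlonglongrightarrow> r) = r"
      using all LIMSEQ_unique[OF _ r] \<open>s \<in> \<xi>\<close> \<open>t \<in> \<eta>\<close> by (intro the_equality) blast+
    then show ?thesis using \<xi> \<eta> by (simp add: completion_dist_def)
  qed
  with r show ?thesis by simp
qed

lemma cauchy_completion_nonempty:
  assumes "\<xi> \<in> cauchy_completion M d"
  shows "\<exists>s. s \<in> \<xi> \<and> MCauchy s"
proof -
  obtain s where "MCauchy s" "\<xi> = cauchy_equiv M d `` {s}"
    using assms unfolding cauchy_completion_def by (auto elim: quotientE)
  then show ?thesis
    using equiv_class_self[OF equiv_cauchy_equiv] by auto
qed

lemma Metric_space_completion: "Metric_space (cauchy_completion M d) (completion_dist M d)"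
proof -
  let ?C = "cauchy_completion M d" and ?D = "completion_dist M d"
  have nonneg: "0 \<le> ?D \<xi> \<eta>" if C: "\<xi> \<in> ?C" "\<eta> \<in> ?C" for \<xi> \<eta>
  proof -
    obtain s t where "s \<in> \<xi>" "t \<in> \<eta>" using C[THEN cauchy_completion_nonempty] by blast
    then have "(\<lambda>n. d (s n) (t n)) \<longlonglongrightarrow> ?D \<xi> \<eta>" using completion_dist_tendsto[OF C] by blast
    then show ?thesis by (rule LIMSEQ_le_const) simp
  qed
  have zero: "?D \<xi> \<eta> = 0 \<longleftrightarrow> \<xi> = \<eta>" if C: "\<xi> \<in> ?C" "\<eta> \<in> ?C" for \<xi> \<eta>
  proof -
    obtain s t where st: "s \<in> \<xi>" "t \<in> \<eta>" "MCauchy s" "MCauchy t"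
      using C[THEN cauchy_completion_nonempty] by blast
    have "?D \<xi> \<eta> = 0 \<longleftrightarrow> (s, t) \<in> cauchy_equiv M d"
      using completion_dist_tendsto[OF that st(1,2)] st(3,4)
      by (auto simp: cauchy_equiv_def intro: LIMSEQ_unique)
    also have "\<dots> \<longleftrightarrow> \<xi> = \<eta>"
      using quotient_eq_iff[OF equiv_cauchy_equiv _ _ st(1,2)] that
      unfolding cauchy_completion_def by blast
    finally show ?thesis .
  qed
  have tri: "?D \<xi> \<zeta> \<le> ?D \<xi> \<eta> + ?D \<eta> \<zeta>" if C: "\<xi> \<in> ?C" "\<eta> \<in> ?C" "\<zeta> \<in> ?C" for \<xi> \<eta> \<zeta>
  proof -
    obtain s t u where st: "s \<in> \<xi>" "t \<in> \<eta>" "u \<in> \<zeta>" "MCauchy s" "MCauchy t" "MCauchy u"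
      using C[THEN cauchy_completion_nonempty] by blast
    have "(\<lambda>n. d (s n) (u n)) \<longlonglongrightarrow> ?D \<xi> \<zeta>"
      and "(\<lambda>n. d (s n) (t n) + d (t n) (u n)) \<longlonglongrightarrow> ?D \<xi> \<eta> + ?D \<eta> \<zeta>"
      using that st by (auto intro!: tendsto_add completion_dist_tendsto)
    moreover have "d (s n) (u n) \<le> d (s n) (t n) + d (t n) (u n)" for n
      using st by (intro triangle) (auto simp: MCauchy_def)
    ultimately show ?thesis using LIMSEQ_le by blast
  qed
  have sym: "?D \<xi> \<eta> = ?D \<eta> \<xi>" for \<xi> \<eta>
  proof (cases "\<xi> \<in> ?C \<and> \<eta> \<in> ?C")
    case True
    then obtain s t where "s \<in> \<xi>" "t \<in> \<eta>" using cauchy_completion_nonempty by blast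
    then show ?thesis
      using completion_dist_tendsto[of \<xi> \<eta> s t] completion_dist_tendsto[of \<eta> \<xi> t s] True
      by (auto simp: commute intro: LIMSEQ_unique)
  next
    case False
    then show ?thesis by (auto simp: completion_dist_def)
  qed
  have "0 \<le> ?D \<xi> \<eta>" for \<xi> \<eta>
    using nonneg[of \<xi> \<eta>] by (cases "\<xi> \<in> ?C \<and> \<eta> \<in> ?C") (auto simp: completion_dist_def)
  then show ?thesis
    using sym zero tri by unfold_locales auto
qed

lemma MCauchy_const: "x \<in> M \<Longrightarrow> MCauchy (\<lambda>_. x)"
  by (auto simp: MCauchy_def)

lemma completion_embed_in:
  assumes "x \<in> M" shows "completion_embed M d x \<in> cauchy_completion M d"
  using MCauchy_const[OF assms] unfolding completion_embed_def cauchy_completion_def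
  by (auto intro: quotientI)

lemma completion_dist_embed:
  assumes x: "x \<in> M" and y: "y \<in> M"
  shows "completion_dist M d (completion_embed M d x) (completion_embed M d y) = d x y"
proof -
  have "(\<lambda>_. x) \<in> completion_embed M d x" "(\<lambda>_. y) \<in> completion_embed M d y"
    using MCauchy_const[OF x] MCauchy_const[OF y] equiv_class_self[OF equiv_cauchy_equiv]
    by (auto simp: completion_embed_def)
  from completion_dist_tendsto[OF completion_embed_in[OF x] completion_embed_in[OF y] this]
  show ?thesis by (simp add: LIMSEQ_const_iff)
qed

end


section \<open>Graphs and Floyd completions\<close>

definition simple_graph :: "'v set \<Rightarrow> 'v set set \<Rightarrow> bool" where
  "simple_graph V E \<longleftrightarrow> (\<forall>e\<in>E. e \<subseteq> V \<and> card e = 2)"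

definition locally_finite_graph :: "'v set \<Rightarrow> 'v set set \<Rightarrow> bool" where
  "locally_finite_graph V E \<longleftrightarrow> (\<forall>v\<in>V. finite {e \<in> E. v \<in> e})"

definition graph_path :: "'v set set \<Rightarrow> 'v \<Rightarrow> 'v list \<Rightarrow> 'v \<Rightarrow> bool" where
  "graph_path E x xs y \<longleftrightarrow>
     xs \<noteq> [] \<and> hd xs = x \<and> last xs = y \<and> successively (\<lambda>a b. {a, b} \<in> E) xs"

definition connected_graph :: "'v set \<Rightarrow> 'v set set \<Rightarrow> bool" where
  "connected_graph V E \<longleftrightarrow> (\<forall>x\<in>V. \<forall>y\<in>V. \<exists>xs. graph_path E x xs y)"

definition graph_dist :: "'v set set \<Rightarrow> 'v \<Rightarrow> 'v \<Rightarrow> nat" where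
  "graph_dist E x y = Inf {length xs - 1 | xs. graph_path E x xs y}"

text \<open>A Floyd function is defined on the positive integers only: no condition involves \<open>f 0\<close>, and
  the convention \<open>f(0) := f(1)\<close> appears as \<open>max 1\<close> in the length of an edge.\<close>

definition floyd_function :: "(nat \<Rightarrow> real) \<Rightarrow> bool" where
  "floyd_function f \<longleftrightarrow>
     (\<forall>n\<ge>1. f n > 0) \<and>
     (\<exists>K>0. \<forall>n\<ge>1. 1 \<le> f n / f (n + 1) \<and> f n / f (n + 1) \<le> K) \<and>
     summable (\<lambda>n. f (n + 1))"

definition floyd_edge_length :: "(nat \<Rightarrow> real) \<Rightarrow> 'v set set \<Rightarrow> 'v \<Rightarrow> 'v set \<Rightarrow> real" where
  "floyd_edge_length f E v e = f (max 1 (Min (graph_dist E v ` e)))"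

definition floyd_length :: "(nat \<Rightarrow> real) \<Rightarrow> 'v set set \<Rightarrow> 'v \<Rightarrow> 'v list \<Rightarrow> real" where
  "floyd_length f E v xs = (\<Sum>(a, b)\<leftarrow>zip xs (tl xs). floyd_edge_length f E v {a, b})"

definition floyd_dist ::
    "(nat \<Rightarrow> real) \<Rightarrow> 'v set \<Rightarrow> 'v set set \<Rightarrow> 'v \<Rightarrow> 'v \<Rightarrow> 'v \<Rightarrow> real" where
  "floyd_dist f V E v x y =
     (if x \<in> V \<and> y \<in> V then Inf {floyd_length f E v xs | xs. graph_path E x xs y} else 0)"

lemma graph_path_rev: "graph_path E x xs y \<Longrightarrow> graph_path E y (rev xs) x"
  by (auto simp: graph_path_def hd_rev last_rev insert_commute)

lemma floyd_length_Cons: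
  "xs \<noteq> [] \<Longrightarrow> floyd_length f E v (x # xs) = floyd_edge_length f E v {x, hd xs} + floyd_length f E v xs"
  by (cases xs) (auto simp: floyd_length_def)

lemma floyd_length_append:
  "\<lbrakk>xs \<noteq> []; ys \<noteq> []; last xs = hd ys\<rbrakk> \<Longrightarrow>
     floyd_length f E v (xs @ tl ys) = floyd_length f E v xs + floyd_length f E v ys"
proof (induction xs)
  case (Cons x xs)
  show ?case
  proof (cases "xs = []")
    case True
    with Cons.prems have "[x] @ tl ys = ys" by (cases ys) auto
    with True show ?thesis by (simp add: floyd_length_def)
  next
    case False
    with Cons show ?thesis by (simp add: floyd_length_Cons)
  qed
qed simp

lemma floyd_length_rev: "floyd_length f E v (rev xs) = floyd_length f E v xs"
proof (induction xs)
  case (Cons x xs)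
  show ?case
  proof (cases "xs = []")
    case False
    then have "floyd_length f E v (rev xs @ tl [hd xs, x]) = 
               floyd_length f E v (rev xs) + floyd_length f E v [hd xs, x]"
      by (intro floyd_length_append) (auto simp: last_rev)
    with False Cons show ?thesis
      by (simp add: floyd_length_Cons) (simp add: floyd_length_def insert_commute)
  qed (simp add: floyd_length_def)
qed (simp add: floyd_length_def)

lemma graph_path_append:
  assumes "graph_path E x xs y" "graph_path E y ys z"
  shows "graph_path E x (xs @ tl ys) z"
proof (cases ys)
  case (Cons a as)
  with assms show ?thesis
    by (cases as) (auto simp: graph_path_def successively_append_iff)
qed (use assms in \<open>auto simp: graph_path_def\<close>)

lemma Metric_space_floyd:
  assumes G: "simple_graph V E" "connected_graph V E" "locally_finite_graph V E"
    and f: "floyd_function f"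
  shows "Metric_space V (floyd_dist f V E v)"
proof -
  have epos: "0 < floyd_edge_length f E v e" for e
    using f by (simp add: floyd_edge_length_def floyd_function_def)
  have lnn: "0 \<le> floyd_length f E v xs" for xs
    unfolding floyd_length_def using epos
    by (intro sum_list_nonneg) (auto simp: less_imp_le)
  define L where "L x y = {floyd_length f E v xs | xs. graph_path E x xs y}" for x y
  have D: "floyd_dist f V E v x y = Inf (L x y)" if "x \<in> V" "y \<in> V" for x y
    using that by (simp add: floyd_dist_def L_def)
  have ne: "L x y \<noteq> {}" if "x \<in> V" "y \<in> V" for x y
    using G(2) that by (auto simp: connected_graph_def L_def)
  have bdd: "bdd_below (L x y)" for x y
    using lnn by (auto simp: L_def intro!: bdd_belowI[of _ 0])
  have nonneg: "0 \<le> floyd_dist f V E v x y" for x y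
    using ne[of x y] lnn by (cases "x \<in> V \<and> y \<in> V") (auto simp: D L_def floyd_dist_def intro!: cInf_greatest)
  have "L x y \<subseteq> L y x" for x y
    unfolding L_def using graph_path_rev[of E x _ y] floyd_length_rev[of f E v, symmetric] by blast
  then have sym: "floyd_dist f V E v x y = floyd_dist f V E v y x" for x y
    using D by (metis floyd_dist_def subset_antisym)
  have tri: "floyd_dist f V E v x z \<le> floyd_dist f V E v x y + floyd_dist f V E v y z"
    if V: "x \<in> V" "y \<in> V" "z \<in> V" for x y z
  proof -
    have *: "Inf (L x z) \<le> a + b" if ab: "a \<in> L x y" "b \<in> L y z" for a b
    proof -
      obtain xs ys where xs: "graph_path E x xs y" "a = floyd_length f E v xs"
        and ys: "graph_path E y ys z" "b = floyd_length f E v ys" using ab by (auto simp: L_def)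
      then have "a + b = floyd_length f E v (xs @ tl ys)"
        by (subst floyd_length_append) (auto simp: graph_path_def)
      then have "a + b \<in> L x z" using graph_path_append[OF xs(1) ys(1)] by (auto simp: L_def)
      then show ?thesis using bdd by (rule cInf_lower)
    qed
    have "Inf (L x z) - b \<le> Inf (L x y)" if "b \<in> L y z" for b
      using *[OF _ that] ne[OF V(1,2)] by (intro cInf_greatest) (auto simp: algebra_simps)
    then have "Inf (L x z) - Inf (L x y) \<le> Inf (L y z)"
      using ne[OF V(2,3)] by (intro cInf_greatest) (auto simp: algebra_simps)
    then show ?thesis using V by (simp add: D)
  qed
  have pos: "0 < floyd_dist f V E v x y" if V: "x \<in> V" "y \<in> V" and "x \<noteq> y" for x y
  proof -
    define A where "A = insert 1 (floyd_edge_length f E v ` {e \<in> E. x \<in> e})"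
    have A: "finite A" "A \<noteq> {}" using G(3) V by (auto simp: A_def locally_finite_graph_def)
    have "Min A > 0" using A epos by (auto simp: A_def)
    moreover have "Min A \<le> Inf (L x y)"
    proof (rule cInf_greatest[OF ne[OF V]])
      fix l assume "l \<in> L x y"
      then obtain xs where xs: "graph_path E x xs y" "l = floyd_length f E v xs" by (auto simp: L_def)
      with \<open>x \<noteq> y\<close> obtain b ys where b: "xs = x # b # ys" 
        by (cases xs; cases "tl xs") (auto simp: graph_path_def)
      with xs have "{x, b} \<in> E" by (auto simp: graph_path_def)
      then have "Min A \<le> floyd_edge_length f E v {x, b}" using A by (intro Min_le) (auto simp: A_def)
      also have "\<dots> \<le> l" using xs b lnn by (simp add: floyd_length_Cons)
      finally show "Min A \<le> l" .
    qed
    ultimately show ?thesis using V by (simp add: D)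
  qed
  have refl: "floyd_dist f V E v x x = 0" if "x \<in> V" for x
  proof -
    have "0 \<in> L x x" unfolding L_def
      by (rule CollectI, rule exI[of _ "[x]"]) (auto simp: graph_path_def floyd_length_def)
    then have "Inf (L x x) \<le> 0" using bdd by (rule cInf_lower)
    then show ?thesis using nonneg[of x x] that by (simp add: D)
  qed
  show ?thesis
    by unfold_locales (use nonneg sym tri pos refl in \<open>auto simp: less_le\<close>, metis less_irrefl pos)
qed

text \<open>The Cayley graph has an edge from \<open>g\<close> to \<open>g s\<close>, so that left multiplication acts on it; loops
  are dropped.  The base vertex of its Floyd completion is the identity.\<close>

definition cayley_edges :: "('g, 'm) monoid_scheme \<Rightarrow> 'g set \<Rightarrow> 'g set set" where
  "cayley_edges G S = {{g, g \<otimes>\<^bsub>G\<^esub> s} | g s. g \<in> carrier G \<and> s \<in> S \<and> g \<otimes>\<^bsub>G\<^esub> s \<noteq> g}"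

definition group_floyd_dist ::
    "('g, 'm) monoid_scheme \<Rightarrow> 'g set \<Rightarrow> (nat \<Rightarrow> real) \<Rightarrow> 'g \<Rightarrow> 'g \<Rightarrow> real" where
  "group_floyd_dist G S f = floyd_dist f (carrier G) (cayley_edges G S) \<one>\<^bsub>G\<^esub>"

definition floyd_completion ::
    "('g, 'm) monoid_scheme \<Rightarrow> 'g set \<Rightarrow> (nat \<Rightarrow> real) \<Rightarrow> (nat \<Rightarrow> 'g) set topology" where
  "floyd_completion G S f = completion_topology (carrier G) (group_floyd_dist G S f)"

definition floyd_embed ::
    "('g, 'm) monoid_scheme \<Rightarrow> 'g set \<Rightarrow> (nat \<Rightarrow> real) \<Rightarrow> 'g \<Rightarrow> (nat \<Rightarrow> 'g) set" where
  "floyd_embed G S f = completion_embed (carrier G) (group_floyd_dist G S f)"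

definition floyd_boundary ::
    "('g, 'm) monoid_scheme \<Rightarrow> 'g set \<Rightarrow> (nat \<Rightarrow> real) \<Rightarrow> (nat \<Rightarrow> 'g) set set" where
  "floyd_boundary G S f =
     topspace (floyd_completion G S f) - floyd_embed G S f ` carrier G"

text \<open>Left multiplication by \<open>g\<close> is bi-Lipschitz for the Floyd distance, hence maps each equivalence
  class of Cauchy sequences onto an equivalence class.\<close>

definition floyd_action :: "('g, 'm) monoid_scheme \<Rightarrow> 'g \<Rightarrow> (nat \<Rightarrow> 'g) set \<Rightarrow> (nat \<Rightarrow> 'g) set" where
  "floyd_action G g \<xi> = (\<lambda>s n. g \<otimes>\<^bsub>G\<^esub> s n) ` \<xi>"


section \<open>The Floyd map\<close>

definition cofinite_graph_action ::
    "('g, 'm) monoid_scheme \<Rightarrow> 'v set \<Rightarrow> 'v set set \<Rightarrow> ('g \<Rightarrow> 'v \<Rightarrow> 'v) \<Rightarrow> bool" where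
  "cofinite_graph_action G V E \<rho> \<longleftrightarrow>
     group_action G V \<rho> \<and> (\<forall>g\<in>carrier G. \<forall>e\<in>E. \<rho> g ` e \<in> E) \<and>
     finite (orbits G V \<rho>) \<and> finite (orbits G E (\<lambda>g e. \<rho> g ` e))"

definition quasi_isometric_map ::
    "'a set \<Rightarrow> ('a \<Rightarrow> 'a \<Rightarrow> nat) \<Rightarrow> ('b \<Rightarrow> 'b \<Rightarrow> nat) \<Rightarrow> ('a \<Rightarrow> 'b) \<Rightarrow> bool" where
  "quasi_isometric_map A d d' h \<longleftrightarrow>
     (\<exists>c\<ge>1::real. \<forall>x\<in>A. \<forall>y\<in>A.
        d x y / c - c \<le> d' (h x) (h y) \<and> d' (h x) (h y) \<le> c * d x y + c)"

text \<open>A compact Hausdorff topology on the disjoint union of the space \<open>X\<close> and the vertex set \<open>V\<close>,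
  inducing the topology of \<open>X\<close> and the discrete topology of \<open>V\<close>.\<close>

definition compact_sum_topology :: "'a topology \<Rightarrow> 'v set \<Rightarrow> ('a + 'v) topology \<Rightarrow> bool" where
  "compact_sum_topology X V M \<longleftrightarrow>
     topspace M = Inl ` topspace X \<union> Inr ` V \<and>
     compact_space M \<and> Hausdorff_space M \<and>
     embedding_map X M Inl \<and> embedding_map (discrete_topology V) M Inr"

definition sum_action ::
    "('a + 'v) topology \<Rightarrow> ('g \<Rightarrow> 'a \<Rightarrow> 'a) \<Rightarrow> ('g \<Rightarrow> 'v \<Rightarrow> 'v) \<Rightarrow> 'g \<Rightarrow> 'a + 'v \<Rightarrow> 'a + 'v" where
  "sum_action M \<phi> \<rho> g = restrict (map_sum (\<phi> g) (\<rho> g)) (topspace M)"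

text \<open>\<open>F\<^sub>0\<close> is a boundary map of the action \<open>\<phi>\<close> at the exponential function with ratio \<open>lam\<close>, obtained
  from the graph \<open>(V, E)\<close>, the space \<open>M\<close>, the orbit map \<open>\<psi>\<close> and its continuous extension \<open>\<Psi>\<close>.\<close>

definition exponential_floyd_map ::
    "('g, 'm) monoid_scheme \<Rightarrow> 'g set \<Rightarrow> 'a topology \<Rightarrow> ('g \<Rightarrow> 'a \<Rightarrow> 'a) \<Rightarrow> real \<Rightarrow>
     'v set \<Rightarrow> 'v set set \<Rightarrow> ('g \<Rightarrow> 'v \<Rightarrow> 'v) \<Rightarrow> ('a + 'v) topology \<Rightarrow>
     ('g \<Rightarrow> 'v) \<Rightarrow> ((nat \<Rightarrow> 'g) set \<Rightarrow> 'a + 'v) \<Rightarrow> ((nat \<Rightarrow> 'g) set \<Rightarrow> 'a) \<Rightarrow> bool" where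
  "exponential_floyd_map G S X \<phi> lam V E \<rho> M \<psi> \<Psi> F\<^sub>0 \<longleftrightarrow>
     simple_graph V E \<and> locally_finite_graph V E \<and> connected_graph V E \<and>
     cofinite_graph_action G V E \<rho> \<and>
     compact_sum_topology X V M \<and>
     acts_by_homeos G M (sum_action M \<phi> \<rho>) \<and>
     three_discontinuous G M (sum_action M \<phi> \<rho>) \<and>
     \<psi> ` carrier G \<subseteq> V \<and>
     (\<forall>g\<in>carrier G. \<forall>h\<in>carrier G. \<psi> (g \<otimes>\<^bsub>G\<^esub> h) = \<rho> g (\<psi> h)) \<and>
     quasi_isometric_map (carrier G) (graph_dist (cayley_edges G S)) (graph_dist E) \<psi> \<and>
     continuous_map (floyd_completion G S (\<lambda>n. lam ^ n)) M \<Psi> \<and>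
     (\<forall>g\<in>carrier G. \<Psi> (floyd_embed G S (\<lambda>n. lam ^ n) g) = Inr (\<psi> g)) \<and>
     (\<forall>g\<in>carrier G. \<forall>\<xi>\<in>topspace (floyd_completion G S (\<lambda>n. lam ^ n)).
        \<Psi> (floyd_action G g \<xi>) = sum_action M \<phi> \<rho> g (\<Psi> \<xi>)) \<and>
     (\<forall>\<xi>\<in>floyd_boundary G S (\<lambda>n. lam ^ n). F\<^sub>0 \<xi> \<in> topspace X \<and> \<Psi> \<xi> = Inl (F\<^sub>0 \<xi>))"

text \<open>Here \<open>chi\<close> is the (unique) continuous extension to the Floyd completions of the identity of \<open>G\<close>.\<close>

definition extends_identity ::
    "('g, 'm) monoid_scheme \<Rightarrow> 'g set \<Rightarrow> (nat \<Rightarrow> real) \<Rightarrow> (nat \<Rightarrow> real) \<Rightarrow>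
     ((nat \<Rightarrow> 'g) set \<Rightarrow> (nat \<Rightarrow> 'g) set) \<Rightarrow> bool" where
  "extends_identity G S f f\<^sub>0 chi \<longleftrightarrow>
     continuous_map (floyd_completion G S f) (floyd_completion G S f\<^sub>0) chi \<and>
     (\<forall>g\<in>carrier G. chi (floyd_embed G S f g) = floyd_embed G S f\<^sub>0 g)"

end

theory Submission
  imports Defs
begin

text \<open>By Karlsson's lemma a geodesic between Floyd-distant points passes near the identity. If two
  distinct boundary points have the same image \<open>p\<close>, the geodesics joining sequences that converge to
  them therefore all pass near the identity, while their ends tend to \<open>p\<close> in \<open>M\<close>; call \<open>g\<close>
  horocyclic for \<open>p\<close> if it lies on such geodesics. Applied to the exponential Floyd function,
  Karlsson's lemma shows that if \<open>g q\<close> is close to \<open>a\<close> and the identity is horocyclic for \<open>q\<close>, then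
  the vertex of \<open>g\<close> is close to \<open>a\<close>, up to finitely many \<open>g\<close>. Hence a single \<open>g\<close> can separate two
  such points \<open>q\<close> only in finitely many cases, and 2-cocompactness forces the set of these \<open>q\<close> to be
  finite. It follows that the elements that are horocyclic for \<open>p\<close> are at bounded distance from the
  stabilizer of \<open>p\<close>, and they accumulate at both boundary points. The dynamics of the stabilizer on
  \<open>M\<close> is controlled by 3-discontinuity, tested on triples that contain an isolated point, a
  vertex.\<close>

section \<open>Word metric and Floyd distance\<close>

text \<open>Two Floyd functions play different parts. The given \<open>f\<close> measures distances
  in the boundary under study, and Karlsson's lemma for it produces geodesics through a fixed ball.
  The topology of \<open>M\<close> is tied to the exponential function, on whose completion
  \<open>\<Psi>\<close> is continuous; finiteness statements about vertices in closed subsets of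
  \<open>M\<close> come from Karlsson's lemma for that function. Limits of geodesics are avoided:
  all statements speak of elements between two group elements, and the pigeonhole principle in
  finite balls picks out elements that lie between infinitely many of the given pairs.
  3-discontinuity yields finiteness only for triples in pairwise disjoint closed sets, while in the
  space itself only the fixed point \<open>p\<close> and one further point are under control. This
  is why the dynamics is studied in \<open>M\<close>: its vertices are isolated, so a vertex can
  serve as a third point and can be cut out of a closed set that stays closed.\<close>

lemma graph_dist_le: "graph_path E x xs y \<Longrightarrow> graph_dist E x y \<le> length xs - 1"
  unfolding graph_dist_def by (rule cInf_lower) auto

lemma graph_dist_path:
  assumes "connected_graph V E" "x \<in> V" "y \<in> V"
  shows "\<exists>xs. graph_path E x xs y \<and> length xs = Suc (graph_dist E x y)"
proof -
  let ?L = "{length xs - 1 | xs. graph_path E x xs y}"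
  have "?L \<noteq> {}" using assms by (auto simp: connected_graph_def)
  then have "Inf ?L \<in> ?L" by (rule Inf_nat_def1)
  then obtain xs where "graph_path E x xs y" "graph_dist E x y = length xs - 1"
    by (auto simp: graph_dist_def)
  moreover from this have "xs \<noteq> []" by (simp add: graph_path_def)
  ultimately show ?thesis by (intro exI[of _ xs]) (auto simp: Suc_diff_le)
qed

lemma graph_dist_self [simp]: "graph_dist E x x = 0"
  using graph_dist_le[of E x "[x]" x] by (simp add: graph_path_def)

lemma graph_dist_commute: "graph_dist E x y = graph_dist E y x"
proof -
  have sub: "{length xs - 1 | xs. graph_path E x xs y} \<subseteq> {length xs - 1 | xs. graph_path E y xs x}" for x y
  proof
    fix n assume "n \<in> {length xs - 1 | xs. graph_path E x xs y}"
    then obtain xs where "graph_path E x xs y" "n = length xs - 1" by blast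
    then have "graph_path E y (rev xs) x" "n = length (rev xs) - 1"
      by (auto intro: graph_path_rev)
    then show "n \<in> {length xs - 1 | xs. graph_path E y xs x}" by blast
  qed
  show ?thesis unfolding graph_dist_def by (rule arg_cong[OF subset_antisym[OF sub sub]])
qed

lemma graph_dist_edge: "{x, y} \<in> E \<Longrightarrow> graph_dist E x y \<le> 1"
  using graph_dist_le[of E x "[x, y]" y] by (simp add: graph_path_def)

locale connected_simple_graph =
  fixes V :: "'v set" and E :: "'v set set"
  assumes simple: "simple_graph V E" and conn: "connected_graph V E"
begin

lemma dist_triangle:
  assumes "x \<in> V" "y \<in> V" "z \<in> V"
  shows "graph_dist E x z \<le> graph_dist E x y + graph_dist E y z"
proof -
  obtain xs ys where "graph_path E x xs y" "length xs = Suc (graph_dist E x y)"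
    "graph_path E y ys z" "length ys = Suc (graph_dist E y z)"
    using graph_dist_path[OF conn] assms by meson
  then show ?thesis
    using graph_dist_le[OF graph_path_append[of E x xs y ys z]] by simp
qed

lemma dist_0_eq:
  assumes "x \<in> V" "y \<in> V" "graph_dist E x y = 0"
  shows "x = y"
proof -
  obtain xs where "graph_path E x xs y" "length xs = Suc 0"
    using graph_dist_path[OF conn assms(1,2)] assms(3) by auto
  then show ?thesis by (auto simp: graph_path_def length_Suc_conv)
qed

lemma dist_step:
  assumes "x \<in> V" "y \<in> V" "graph_dist E x y = Suc n"
  shows "\<exists>u\<in>V. {x, u} \<in> E \<and> graph_dist E x u = 1 \<and> graph_dist E u y = n"
proof -
  obtain xs where xs: "graph_path E x xs y" "length xs = Suc (Suc n)"
    using graph_dist_path[OF conn assms(1,2)] assms(3) by auto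
  then obtain u ys where ys: "xs = x # u # ys" by (auto simp: graph_path_def length_Suc_conv)
  with xs have e: "{x, u} \<in> E" and p: "graph_path E u (u # ys) y" by (auto simp: graph_path_def)
  then have u: "u \<in> V" using simple by (auto simp: simple_graph_def)
  have "graph_dist E u y \<le> n" using graph_dist_le[OF p] xs ys by simp
  moreover have "graph_dist E x u \<le> 1" using e by (rule graph_dist_edge)
  ultimately show ?thesis using dist_triangle[OF assms(1) u assms(2)] assms(3) u e by fastforce
qed

lemma dist_intermediate:
  assumes "x \<in> V" "y \<in> V" "k \<le> graph_dist E x y"
  shows "\<exists>u\<in>V. graph_dist E x u = k \<and> k + graph_dist E u y = graph_dist E x y"
  using assms(3)
proof (induction k)
  case 0
  then show ?case using assms(1) by (intro bexI[of _ x]) auto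
next
  case (Suc k)
  then obtain u where u: "u \<in> V" "graph_dist E x u = k" "k + graph_dist E u y = graph_dist E x y"
    by auto
  then obtain n where "graph_dist E u y = Suc n" using Suc.prems by (metis add.right_neutral not0_implies_Suc not_less_eq_eq order_refl)
  then obtain w where w: "w \<in> V" "graph_dist E u w = 1" "graph_dist E w y = n"
    using dist_step[OF u(1) assms(2)] by blast
  have "graph_dist E x w \<le> Suc k" using dist_triangle[OF assms(1) u(1) w(1)] u w by simp
  moreover have "graph_dist E x y \<le> graph_dist E x w + n"
    using dist_triangle[OF assms(1) w(1) assms(2)] w by simp
  ultimately show ?case using u w \<open>graph_dist E u y = Suc n\<close> by (intro bexI[of _ w]) auto
qed

lemma finite_ball:
  assumes "locally_finite_graph V E" "v \<in> V"
  shows "finite {x \<in> V. graph_dist E v x \<le> r}"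
proof (induction r)
  case 0
  have "{x \<in> V. graph_dist E v x \<le> 0} \<subseteq> {v}" using dist_0_eq assms(2) by auto
  then show ?case by (rule finite_subset) simp
next
  case (Suc r)
  let ?B = "{x \<in> V. graph_dist E v x \<le> r}"
  have "{x \<in> V. graph_dist E v x \<le> Suc r} \<subseteq> ?B \<union> \<Union> (\<Union>u\<in>?B. {e \<in> E. u \<in> e})"
  proof
    fix x assume x: "x \<in> {x \<in> V. graph_dist E v x \<le> Suc r}"
    show "x \<in> ?B \<union> \<Union> (\<Union>u\<in>?B. {e \<in> E. u \<in> e})"
    proof (cases "graph_dist E v x = Suc r")
      case True
      then obtain u where "u \<in> V" "{x, u} \<in> E" "graph_dist E u v = r"
        using dist_step[of x v r] x assms(2) by (auto simp: graph_dist_commute)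
      then show ?thesis using x by (auto simp: graph_dist_commute)
    qed (use x in auto)
  qed
  moreover have "finite (\<Union> (\<Union>u\<in>?B. {e \<in> E. u \<in> e}))"
  proof (rule finite_Union)
    show "finite (\<Union>u\<in>?B. {e \<in> E. u \<in> e})"
      using Suc assms(1) by (intro finite_UN_I) (auto simp: locally_finite_graph_def)
    show "finite e" if "e \<in> (\<Union>u\<in>?B. {e \<in> E. u \<in> e})" for e
      using that simple by (auto simp: simple_graph_def intro: card_ge_0_finite)
  qed
  ultimately show ?case using Suc by (meson finite_Un finite_subset)
qed

end

section \<open>Floyd functions and the tails of their series\<close>

lemma floyd_function_antimono:
  assumes "floyd_function f" "1 \<le> m" "m \<le> n"
  shows "f n \<le> f m"
  using assms(3)
proof (induction rule: dec_induct)
  case (step k)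
  then have "f (k + 1) > 0" "1 \<le> f k / f (k + 1)" 
    using assms(1,2) unfolding floyd_function_def by (auto simp: le_trans)
  then have "f (Suc k) \<le> f k" by (simp add: field_simps)
  with step show ?case by linarith
qed simp

lemma floyd_function_pos: "floyd_function f \<Longrightarrow> 1 \<le> n \<Longrightarrow> 0 < f n"
  by (auto simp: floyd_function_def)

lemma floyd_function_power:
  assumes "0 < lam" "lam < 1"
  shows "floyd_function (\<lambda>n. lam ^ n)"
proof -
  have "summable (\<lambda>n. lam ^ (n + 1))"
    using summable_mult[OF summable_geometric[of lam], of lam] assms by simp
  moreover have "\<exists>K>0. \<forall>n\<ge>1. 1 \<le> lam ^ n / lam ^ (n + 1) \<and> lam ^ n / lam ^ (n + 1) \<le> K"
    using assms by (intro exI[of _ "1 / lam"]) (auto simp: field_simps)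
  ultimately show ?thesis using assms by (simp add: floyd_function_def)
qed

text \<open>Dividing the argument by three accounts for the fact that a geodesic with closest point \<open>z\<close> to
  the base point is, at distance \<open>j\<close> from \<open>z\<close>, at distance at least \<open>max D (j - D)\<close>, hence
  \<open>(D + j) / 3\<close>, from the base point, where \<open>D\<close> is that of \<open>z\<close>.\<close>

definition floyd_third :: "(nat \<Rightarrow> real) \<Rightarrow> nat \<Rightarrow> real" where
  "floyd_third f j = f (max 1 (j div 3))"

definition floyd_tail :: "(nat \<Rightarrow> real) \<Rightarrow> nat \<Rightarrow> real" where
  "floyd_tail f D = (\<Sum>j. floyd_third f (D + j))"

context
  fixes f assumes f: "floyd_function f"
begin

lemma floyd_third_pos: "0 < floyd_third f j"
  using f by (simp add: floyd_third_def floyd_function_pos)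

text \<open>Three consecutive arguments share one quotient by three, so a block contributes
  \<open>3 * f (max 1 k)\<close>. The block \<open>k = 0\<close> accounts for the additional
  \<open>f 1\<close> in the bound.\<close>

lemma summable_floyd_third: "summable (floyd_third f)"
proof -
  have s: "summable (\<lambda>n. f (n + 1))" using f by (simp add: floyd_function_def)
  have bound: "(\<Sum>j<n. floyd_third f j) \<le> 3 * (f 1 + (\<Sum>k. f (k + 1)))" for n
  proof -
    have "(\<Sum>j<n. floyd_third f j) \<le> (\<Sum>j<n*3. floyd_third f j)"
      by (rule sum_mono2) (auto intro: less_imp_le floyd_third_pos)
    also have "\<dots> = (\<Sum>k<n. sum (floyd_third f) {k*3..<k*3+3})"
      by (rule sum.nat_group[symmetric])
    also have "\<dots> = (\<Sum>k<n. 3 * f (max 1 k))"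
    proof (rule sum.cong[OF refl])
      fix k
      have "sum (floyd_third f) {k*3..<k*3+3} = sum (\<lambda>_. f (max 1 k)) {k*3..<k*3+3}"
      proof (rule sum.cong[OF refl])
        fix j assume "j \<in> {k*3..<k*3+3}"
        then have "j div 3 = k" by auto
        then show "floyd_third f j = f (max 1 k)" by (simp add: floyd_third_def)
      qed
      then show "sum (floyd_third f) {k*3..<k*3+3} = 3 * f (max 1 k)" by simp
    qed
    also have "\<dots> = 3 * (\<Sum>k<n. f (max 1 k))" by (simp add: sum_distrib_left)
    also have "(\<Sum>k<n. f (max 1 k)) \<le> (\<Sum>k<Suc n. f (max 1 k))"
      using floyd_function_pos[OF f, of "max 1 n"] by simp
    also have "(\<Sum>k<Suc n. f (max 1 k)) = f 1 + (\<Sum>k<n. f (k + 1))"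
      by (subst sum.lessThan_Suc_shift) simp
    also have "(\<Sum>k<n. f (k + 1)) \<le> (\<Sum>k. f (k + 1))"
      using s floyd_function_pos[OF f] by (intro sum_le_suminf) (auto intro: less_imp_le)
    finally show ?thesis by simp
  qed
  show ?thesis
    by (rule bounded_imp_summable[where B = "3 * (f 1 + (\<Sum>k. f (k + 1)))"])
       (simp add: floyd_third_pos less_imp_le, metis bound lessThan_Suc_atMost)
qed

lemma floyd_tail_ge: "(\<Sum>j<n. floyd_third f (D + j)) \<le> floyd_tail f D"
  unfolding floyd_tail_def
  using summable_ignore_initial_segment[OF summable_floyd_third, of D] floyd_third_pos
  by (intro sum_le_suminf) (auto simp: add.commute less_imp_le)

lemma floyd_tail_tendsto: "floyd_tail f \<longlonglongrightarrow> 0"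
  using suminf_exist_split2[OF summable_floyd_third]
  by (simp add: floyd_tail_def[abs_def] add.commute)

lemma floyd_tail_small: "0 < e \<Longrightarrow> \<exists>R. \<forall>D\<ge>R. floyd_tail f D < e"
  using floyd_tail_tendsto order_tendstoD(2)[of "floyd_tail f" 0 sequentially e]
  by (auto simp: eventually_sequentially)

end

section \<open>The Cayley graph and its word metric\<close>

locale cayley = group G for G (structure) +
  fixes S :: "'a set"
  assumes fin: "finite S" and sub: "S \<subseteq> carrier G" and gen: "generate G S = carrier G"
begin

abbreviation wd :: "'a \<Rightarrow> 'a \<Rightarrow> nat" where "wd \<equiv> graph_dist (cayley_edges G S)"

abbreviation wlen :: "'a \<Rightarrow> nat" where "wlen \<equiv> wd \<one>"

text \<open>The metric interval from \<open>x\<close> to \<open>y\<close>. It stands for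
  "\<open>u\<close> lies on some geodesic", so that no geodesic has to be chosen or carried along as
  a list.\<close>

definition between :: "'a \<Rightarrow> 'a \<Rightarrow> 'a \<Rightarrow> bool" where
  "between x u y \<longleftrightarrow> x \<in> carrier G \<and> u \<in> carrier G \<and> y \<in> carrier G \<and> wd x u + wd u y = wd x y"

lemma graph_path_mult:
  assumes p: "graph_path (cayley_edges G S) x xs y" and k: "k \<in> carrier G"
  shows "graph_path (cayley_edges G S) (k \<otimes> x) (map (\<lambda>z. k \<otimes> z) xs) (k \<otimes> y)"
proof -
  have e: "{k \<otimes> a, k \<otimes> b} \<in> cayley_edges G S" if "{a, b} \<in> cayley_edges G S" for a b
  proof -
    obtain g s where gs: "{a, b} = {g, g \<otimes> s}" "g \<in> carrier G" "s \<in> S" "g \<otimes> s \<noteq> g"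
      using \<open>{a, b} \<in> cayley_edges G S\<close> by (auto simp: cayley_edges_def)
    have s: "s \<in> carrier G" using gs sub by auto
    have "{k \<otimes> a, k \<otimes> b} = (\<lambda>z. k \<otimes> z) ` {a, b}" by auto
    also have "\<dots> = {k \<otimes> g, (k \<otimes> g) \<otimes> s}" using gs k s by (simp add: m_assoc)
    finally show ?thesis
      unfolding cayley_edges_def using gs k s
      by (intro CollectI exI[of _ "k \<otimes> g"] exI[of _ s]) (auto simp: m_assoc)
  qed
  show ?thesis
    using p unfolding graph_path_def
    by (auto simp: hd_map last_map successively_map intro: successively_mono e)
qed

lemma simple_cayley: "simple_graph (carrier G) (cayley_edges G S)"
  using sub by (auto simp: simple_graph_def cayley_edges_def)

lemma cayley_edge: "g \<in> carrier G \<Longrightarrow> s \<in> S \<Longrightarrow> g \<otimes> s \<noteq> g \<Longrightarrow> {g, g \<otimes> s} \<in> cayley_edges G S"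
  by (auto simp: cayley_edges_def)

text \<open>The starting point is quantified inside the induction because a product
  \<open>g \<otimes> h\<close> needs the second path to start at
  \<open>x \<otimes> g\<close>.\<close>

lemma path_to_mult:
  assumes "g \<in> generate G S"
  shows "\<forall>x\<in>carrier G. \<exists>xs. graph_path (cayley_edges G S) x xs (x \<otimes> g)"
  using assms
proof (induction rule: generate.induct)
  case one
  then show ?case
    by (auto intro!: exI[of _ "[_]"] simp: graph_path_def)
next
  case (incl s)
  show ?case
  proof
    fix x assume x: "x \<in> carrier G"
    show "\<exists>xs. graph_path (cayley_edges G S) x xs (x \<otimes> s)"
    proof (cases "x \<otimes> s = x")
      case True then show ?thesis by (intro exI[of _ "[x]"]) (simp add: graph_path_def)
    next
      case False then show ?thesis using cayley_edge[OF x incl]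
        by (intro exI[of _ "[x, x \<otimes> s]"]) (simp add: graph_path_def)
    qed
  qed
next
  case (inv s)
  show ?case
  proof
    fix x assume x: "x \<in> carrier G"
    have s: "s \<in> carrier G" using inv sub by auto
    let ?y = "x \<otimes> inv s"
    have y: "?y \<in> carrier G" "?y \<otimes> s = x" using x s by (auto simp: m_assoc)
    show "\<exists>xs. graph_path (cayley_edges G S) x xs (x \<otimes> inv s)"
    proof (cases "?y = x")
      case True then show ?thesis by (intro exI[of _ "[x]"]) (simp add: graph_path_def)
    next
      case False then show ?thesis using cayley_edge[OF y(1) inv] y(2)
        by (intro exI[of _ "[x, ?y]"]) (auto simp: graph_path_def insert_commute)
    qed
  qed
next
  case (eng g h)
  have g: "g \<in> carrier G" and h: "h \<in> carrier G" using eng.hyps gen by auto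
  show ?case
  proof
    fix x assume x: "x \<in> carrier G"
    obtain xs where "graph_path (cayley_edges G S) x xs (x \<otimes> g)" using eng.IH x by blast
    moreover obtain ys where "graph_path (cayley_edges G S) (x \<otimes> g) ys (x \<otimes> g \<otimes> h)"
      using eng.IH x g by blast
    ultimately show "\<exists>xs. graph_path (cayley_edges G S) x xs (x \<otimes> (g \<otimes> h))"
      using graph_path_append x g h by (metis m_assoc)
  qed
qed

lemma connected_cayley: "connected_graph (carrier G) (cayley_edges G S)"
  unfolding connected_graph_def
proof (intro ballI)
  fix x y assume "x \<in> carrier G" "y \<in> carrier G"
  then have "inv x \<otimes> y \<in> generate G S" "x \<otimes> (inv x \<otimes> y) = y" using gen by (auto simp: m_assoc[symmetric])
  then show "\<exists>xs. graph_path (cayley_edges G S) x xs y"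
    using path_to_mult \<open>x \<in> carrier G\<close> by metis
qed

lemma locally_finite_cayley: "locally_finite_graph (carrier G) (cayley_edges G S)"
  unfolding locally_finite_graph_def
proof
  fix v assume v: "v \<in> carrier G"
  have "{e \<in> cayley_edges G S. v \<in> e} \<subseteq> (\<lambda>s. {v, v \<otimes> s}) ` S \<union> (\<lambda>s. {v \<otimes> inv s, v}) ` S"
  proof
    fix e assume "e \<in> {e \<in> cayley_edges G S. v \<in> e}"
    then obtain g s where gs: "e = {g, g \<otimes> s}" "g \<in> carrier G" "s \<in> S" "v \<in> e"
      by (auto simp: cayley_edges_def)
    moreover have "g = v \<otimes> inv s" if "v = g \<otimes> s" using that gs sub by (auto simp: m_assoc)
    ultimately show "e \<in> (\<lambda>s. {v, v \<otimes> s}) ` S \<union> (\<lambda>s. {v \<otimes> inv s, v}) ` S" by auto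
  qed
  then show "finite {e \<in> cayley_edges G S. v \<in> e}" using fin by (meson finite_Un finite_imageI finite_subset)
qed

sublocale connected_simple_graph "carrier G" "cayley_edges G S"
  by unfold_locales (fact simple_cayley connected_cayley)+

lemma finite_wball: "finite {g \<in> carrier G. wlen g \<le> r}"
  using finite_ball[OF locally_finite_cayley] by auto

lemma wd_mult:
  assumes "k \<in> carrier G" "x \<in> carrier G" "y \<in> carrier G"
  shows "wd (k \<otimes> x) (k \<otimes> y) = wd x y"
proof -
  have le: "wd (k \<otimes> x) (k \<otimes> y) \<le> wd x y" 
    if "k \<in> carrier G" "x \<in> carrier G" "y \<in> carrier G" for k x y
  proof -
    obtain xs where "graph_path (cayley_edges G S) x xs y" "length xs = Suc (wd x y)"
      using graph_dist_path[OF conn] \<open>x \<in> carrier G\<close> \<open>y \<in> carrier G\<close> by blast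
    then show ?thesis using graph_dist_le[OF graph_path_mult[OF _ \<open>k \<in> carrier G\<close>]] by fastforce
  qed
  show ?thesis
    using le[OF assms] le[of "inv k" "k \<otimes> x" "k \<otimes> y"] assms by (simp add: m_assoc[symmetric])
qed

lemma between_mult: "k \<in> carrier G \<Longrightarrow> between x u y \<Longrightarrow> between (k \<otimes> x) (k \<otimes> u) (k \<otimes> y)"
  by (auto simp: between_def wd_mult)

lemma between_sym: "between x u y \<Longrightarrow> between y u x"
  by (auto simp: between_def graph_dist_commute)

lemma between_trans: "between x z y \<Longrightarrow> between z u y \<Longrightarrow> between x u y \<and> between x z u"
  using dist_triangle[of x z u] dist_triangle[of x u y] by (auto simp: between_def)

lemma between_self: "x \<in> carrier G \<Longrightarrow> y \<in> carrier G \<Longrightarrow> between x x y \<and> between x y y"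
  by (auto simp: between_def)

lemma between_exists:
  "x \<in> carrier G \<Longrightarrow> y \<in> carrier G \<Longrightarrow> k \<le> wd x y \<Longrightarrow> \<exists>u. between x u y \<and> wd x u = k"
  using dist_intermediate[of x y k] by (auto simp: between_def)

section \<open>Floyd distance along geodesics\<close>

abbreviation fd where "fd f \<equiv> group_floyd_dist G S f"

lemma Metric_space_fd: "floyd_function f \<Longrightarrow> Metric_space (carrier G) (fd f)"
  unfolding group_floyd_dist_def
  by (rule Metric_space_floyd[OF simple_cayley connected_cayley locally_finite_cayley])

lemma fd_edge:
  assumes f: "floyd_function f" and e: "{x, y} \<in> cayley_edges G S"
  shows "fd f x y \<le> f (max 1 (min (wlen x) (wlen y)))"
proof -
  have V: "x \<in> carrier G" "y \<in> carrier G" using e simple_cayley by (auto simp: simple_graph_def)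
  have pos: "0 \<le> floyd_length f (cayley_edges G S) \<one> xs" for xs
    unfolding floyd_length_def floyd_edge_length_def using floyd_function_pos[OF f]
    by (intro sum_list_nonneg) (auto simp: less_imp_le)
  have "floyd_length f (cayley_edges G S) \<one> [x, y] = f (max 1 (min (wlen x) (wlen y)))"
    by (simp add: floyd_length_def floyd_edge_length_def)
  moreover have "graph_path (cayley_edges G S) x [x, y] y" using e by (simp add: graph_path_def)
  ultimately show ?thesis
    using V pos unfolding group_floyd_dist_def floyd_dist_def
    by (auto intro!: cInf_lower bdd_belowI[of _ 0] exI[of _ "[x, y]"])
qed

text \<open>A path that leaves \<open>x\<close> begins with an edge at \<open>x\<close>, and such an
  edge is no farther from the identity than \<open>x\<close>. The bound makes the elements of
  \<open>G\<close> isolated in the completion.\<close>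

lemma fd_isolated:
  assumes f: "floyd_function f" and V: "x \<in> carrier G" "y \<in> carrier G" and ne: "x \<noteq> y"
  shows "f (max 1 (wlen x)) \<le> fd f x y"
proof -
  have pos: "0 \<le> floyd_length f (cayley_edges G S) \<one> xs" for xs
    unfolding floyd_length_def floyd_edge_length_def using floyd_function_pos[OF f]
    by (intro sum_list_nonneg) (auto simp: less_imp_le)
  have "f (max 1 (wlen x)) \<le> Inf {floyd_length f (cayley_edges G S) \<one> xs |xs. graph_path (cayley_edges G S) x xs y}"
  proof (rule cInf_greatest)
    show "{floyd_length f (cayley_edges G S) \<one> xs |xs. graph_path (cayley_edges G S) x xs y} \<noteq> {}"
      using connected_cayley V by (auto simp: connected_graph_def)
    fix l assume "l \<in> {floyd_length f (cayley_edges G S) \<one> xs |xs. graph_path (cayley_edges G S) x xs y}"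
    then obtain xs where xs: "graph_path (cayley_edges G S) x xs y" "l = floyd_length f (cayley_edges G S) \<one> xs"
      by auto
    with ne obtain b ys where b: "xs = x # b # ys" 
      by (cases xs; cases "tl xs") (auto simp: graph_path_def)
    have "f (max 1 (wlen x)) \<le> f (max 1 (min (wlen x) (wlen b)))"
      by (rule floyd_function_antimono[OF f]) auto
    also have "\<dots> = floyd_edge_length f (cayley_edges G S) \<one> {x, b}" by (simp add: floyd_edge_length_def)
    also have "\<dots> \<le> l" using xs b pos by (simp add: floyd_length_Cons)
    finally show "f (max 1 (wlen x)) \<le> l" .
  qed
  then show ?thesis using V by (simp add: group_floyd_dist_def floyd_dist_def)
qed

text \<open>A geodesic is built edge by edge: the first edge costs at most
  \<open>floyd_third f D\<close>, and the rest satisfies the hypothesis with \<open>D\<close> raised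
  by one, since distances to the starting point drop by one.\<close>

lemma fd_le_tail_sum:
  assumes f: "floyd_function f"
  shows "x \<in> carrier G \<Longrightarrow> y \<in> carrier G \<Longrightarrow> wd x y = n \<Longrightarrow>
    (\<And>u. between x u y \<Longrightarrow> (D + wd x u) div 3 \<le> wlen u) \<Longrightarrow>
    fd f x y \<le> (\<Sum>j<n. floyd_third f (D + j))"
proof (induction n arbitrary: x D)
  interpret M: Metric_space "carrier G" "fd f" by (rule Metric_space_fd[OF f])
  case 0
  then show ?case using dist_0_eq by fastforce
next
  interpret M: Metric_space "carrier G" "fd f" by (rule Metric_space_fd[OF f])
  case (Suc n)
  obtain u where u: "u \<in> carrier G" "{x, u} \<in> cayley_edges G S" "wd x u = 1" "wd u y = n"
    using dist_step[OF Suc.prems(1-3)] by blast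
  have xu: "between x u y" using u Suc.prems by (auto simp: between_def)
  have "fd f u y \<le> (\<Sum>j<n. floyd_third f (Suc D + j))"
  proof (rule Suc.IH[OF u(1) Suc.prems(2) u(4)])
    fix w assume w: "between u w y"
    have "between x w y" "between x u w" using between_trans[OF xu w] by auto
    with Suc.prems(4)[of w] u(3) show "(Suc D + wd u w) div 3 \<le> wlen w"
      by (auto simp: between_def)
  qed
  moreover have "fd f x u \<le> floyd_third f D"
  proof -
    have "D div 3 \<le> wlen x" using Suc.prems(4)[of x] between_self Suc.prems by simp
    moreover have "Suc D div 3 \<le> wlen u" using Suc.prems(4)[OF xu] u by simp
    moreover have "D div 3 \<le> Suc D div 3" by (rule div_le_mono) simp
    ultimately have "f (max 1 (min (wlen x) (wlen u))) \<le> f (max 1 (D div 3))"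
      by (intro floyd_function_antimono[OF f]) auto
    then show ?thesis using fd_edge[OF f u(2)] by (simp add: floyd_third_def)
  qed
  moreover have "fd f x y \<le> fd f x u + fd f u y" using M.triangle u Suc.prems by blast
  moreover have "(\<Sum>j<Suc n. floyd_third f (D + j)) = floyd_third f D + (\<Sum>j<n. floyd_third f (Suc D + j))"
    by (subst sum.lessThan_Suc_shift) simp
  ultimately show ?case by linarith
qed

lemma fd_le_tail:
  assumes "floyd_function f" "x \<in> carrier G" "y \<in> carrier G"
    "\<And>u. between x u y \<Longrightarrow> D + wd x u \<le> 3 * wlen u"
  shows "fd f x y \<le> floyd_tail f D"
proof -
  have "(D + wd x u) div 3 \<le> wlen u" if "between x u y" for u using assms(4)[OF that] by linarith
  then show ?thesis
    using fd_le_tail_sum[OF assms(1-3) refl, of D] floyd_tail_ge[OF assms(1), where D=D] order_trans by blast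
qed

text \<open>Every \<open>u\<close> between has \<open>wlen u \<ge> wlen x - wd x u\<close> and
  \<open>wd x u \<le> r\<close>; then \<open>2 * r \<le> wlen x\<close> is what
  \<open>fd_le_tail\<close> asks for with \<open>D = wlen x\<close>.\<close>

lemma fd_near:
  assumes f: "floyd_function f" and V: "x \<in> carrier G" "y \<in> carrier G"
    and "wd x y \<le> r" "2 * r \<le> wlen x"
  shows "fd f x y \<le> floyd_tail f (wlen x)"
proof (rule fd_le_tail[OF f V])
  fix u assume "between x u y"
  then show "wlen x + wd x u \<le> 3 * wlen u"
    using dist_triangle[of \<one> u x] assms by (auto simp: between_def graph_dist_commute)
qed

text \<open>Beyond \<open>z\<close>, a geodesic issuing from \<open>s\<close> recedes from the
  identity at unit speed, up to the error \<open>wlen s\<close>. Hence everything farther along it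
  is Floyd-close to \<open>z\<close>.\<close>

lemma fd_ray:
  assumes f: "floyd_function f" and s: "between s z y" "wlen s \<le> wd s z"
  shows "fd f z y \<le> floyd_tail f (wd s z - wlen s)"
proof (rule fd_le_tail[OF f])
  fix u assume u: "between z u y"
  have "wd s u \<le> wd s \<one> + wlen u" "wd s z + wd z u = wd s u"
    using between_trans[OF s(1) u] dist_triangle[of s \<one> u] by (auto simp: between_def)
  then show "wd s z - wlen s + wd z u \<le> 3 * wlen u"
    using graph_dist_commute[of _ s \<one>] s(2) by simp
qed (use s in \<open>auto simp: between_def\<close>)

text \<open>Karlsson's lemma: a geodesic is split at its point closest to the identity, and both halves are
  Floyd-short if that point is far away.\<close>

lemma karlsson:
  assumes f: "floyd_function f" and e: "0 < e"
  shows "\<exists>R. \<forall>x\<in>carrier G. \<forall>y\<in>carrier G. e \<le> fd f x y \<longrightarrow> (\<exists>u. between x u y \<and> wlen u \<le> R)"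
proof -
  interpret M: Metric_space "carrier G" "fd f" by (rule Metric_space_fd[OF f])
  obtain R where R: "\<And>D. R \<le> D \<Longrightarrow> floyd_tail f D < e / 2"
    using floyd_tail_small[OF f, of "e / 2"] e by auto
  have "\<exists>u. between x u y \<and> wlen u \<le> R" if V: "x \<in> carrier G" "y \<in> carrier G" and le: "e \<le> fd f x y" for x y
  proof (rule ccontr)
    assume no: "\<not> ?thesis"
    obtain z where z: "between x z y" and min: "\<And>u. between x u y \<Longrightarrow> wlen z \<le> wlen u"
      using ex_has_least_nat[of "\<lambda>u. between x u y" x wlen] between_self V by auto
    have zG: "z \<in> carrier G" using z by (simp add: between_def)
    \<comment> \<open>Here \<open>w\<close> is either end. Minimality of \<open>z\<close> gives
      \<open>wlen z + wd z u \<le> 2 * wlen z + wlen u \<le> 3 * wlen u\<close>, which is the source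
      of the factor three.\<close>
    have half: "fd f z w \<le> floyd_tail f (wlen z)" if w: "w \<in> carrier G" "\<And>u. between z u w \<Longrightarrow> between x u y" for w
    proof (rule fd_le_tail[OF f zG w(1)])
      fix u assume u: "between z u w"
      then have "wlen z \<le> wlen u" using w min by blast
      moreover have "wd z u \<le> wlen z + wlen u"
        using u dist_triangle[of z \<one> u] by (auto simp: between_def graph_dist_commute)
      ultimately show "wlen z + wd z u \<le> 3 * wlen u" by simp
    qed
    have "fd f z y \<le> floyd_tail f (wlen z)"
      using half[OF V(2)] between_trans[OF z] by blast
    moreover have "fd f z x \<le> floyd_tail f (wlen z)"
      using half[OF V(1)] between_trans[OF between_sym[OF z]] between_sym by blast
    moreover have "floyd_tail f (wlen z) < e / 2" using no z by (intro R) auto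
    moreover have "fd f x y \<le> fd f z x + fd f z y" using M.triangle[of x z y] M.commute V zG by simp
    ultimately show False using le by linarith
  qed
  then show ?thesis by blast
qed

text \<open>The word ball of radius \<open>R\<close> is a net: \<open>fd_ray\<close> with
  \<open>s = \<one>\<close> joins a remote element to the point where a geodesic from the identity
  leaves the ball. Compactness of the completion enters the proof in this form, as a supply of
  Cauchy subsequences.\<close>

lemma fd_totally_bounded:
  assumes f: "floyd_function f"
  shows "Metric_space.mtotally_bounded (carrier G) (fd f) (carrier G)"
proof -
  interpret M: Metric_space "carrier G" "fd f" by (rule Metric_space_fd[OF f])
  show ?thesis unfolding M.mtotally_bounded_def
  proof (intro allI impI)
    fix e :: real assume "e > 0"
    then obtain R where R: "floyd_tail f R < e" using floyd_tail_small[OF f] by blast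
    let ?K = "{g \<in> carrier G. wlen g \<le> R}"
    have "carrier G \<subseteq> (\<Union>x\<in>?K. M.mball x e)"
    proof
      fix g assume g: "g \<in> carrier G"
      show "g \<in> (\<Union>x\<in>?K. M.mball x e)"
      proof (cases "wlen g \<le> R")
        case True
        then show ?thesis using g \<open>e > 0\<close> by (auto intro!: bexI[of _ g])
      next
        case False
        then obtain z where z: "between \<one> z g" "wlen z = R"
          using between_exists[of \<one> g R] g by auto
        have "fd f z g < e" using fd_ray[OF f z(1)] z(2) R by simp
        then show ?thesis using z g by (auto simp: between_def intro!: bexI[of _ z])
      qed
    qed
    then show "\<exists>K. finite K \<and> K \<subseteq> carrier G \<and> carrier G \<subseteq> (\<Union>x\<in>K. M.mball x e)"
      using finite_wball[of R] by (intro exI[of _ ?K]) auto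
  qed
qed

end

section \<open>Discontinuous and cocompact actions\<close>

text \<open>Boxes over pairwise disjoint closed sets avoid the diagonals, so they remain compact
  among injective tuples and then in the quotient. They are the compact sets on which discontinuity
  is tested.\<close>

lemma compactin_theta:
  assumes "compact_space X"
    and cl: "\<And>i. i < n \<Longrightarrow> closedin X (A i)"
    and disj: "\<And>i j. i < n \<Longrightarrow> j < n \<Longrightarrow> i \<noteq> j \<Longrightarrow> disjnt (A i) (A j)"
  shows "compactin (theta n X) ((\<lambda>x. x ` {..<n}) ` (\<Pi>\<^sub>E i\<in>{..<n}. A i))"
proof -
  let ?Y = "subtopology (product_topology (\<lambda>_. X) {..<n}) {x. inj_on x {..<n}}"
  have "compactin (product_topology (\<lambda>_. X) {..<n}) (\<Pi>\<^sub>E i\<in>{..<n}. A i)"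
    unfolding compactin_PiE by (intro disjI2 ballI closedin_compact_space[OF assms(1)] cl) simp
  moreover have "(\<Pi>\<^sub>E i\<in>{..<n}. A i) \<subseteq> {x. inj_on x {..<n}}"
  proof (intro subsetI CollectI inj_onI)
    fix x i j assume x: "x \<in> (\<Pi>\<^sub>E i\<in>{..<n}. A i)" and ij: "i \<in> {..<n}" "j \<in> {..<n}" "x i = x j"
    have "x i \<in> A i" "x i \<in> A j" using PiE_mem[OF x ij(1)] PiE_mem[OF x ij(2)] ij(3) by simp_all
    then have "\<not> disjnt (A i) (A j)" unfolding disjnt_iff by blast
    then show "i = j" using disj ij(1,2) by blast
  qed
  ultimately have "compactin ?Y (\<Pi>\<^sub>E i\<in>{..<n}. A i)" by (simp add: compactin_subtopology)
  then show ?thesis unfolding theta_def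
    by (rule image_compactin) (intro quotient_imp_continuous_map quotient_map_quotient_topology)
qed

lemma lessThan_3: "{..<3::nat} = {0, 1, 2}"
  by auto

text \<open>Points of the three sources may be chosen independently: disjointness makes them a
  triple, and disjointness of the targets does the same for their images. This is the form in which
  3-discontinuity is applied.\<close>

lemma three_discontinuous_finite:
  fixes X :: "'b topology"
  assumes td: "three_discontinuous G X \<phi>" and X: "compact_space X"
    and A: "closedin X A1" "closedin X A2" "closedin X A3" "disjnt A1 A2" "disjnt A1 A3" "disjnt A2 A3"
    and B: "closedin X B1" "closedin X B2" "closedin X B3" "disjnt B1 B2" "disjnt B1 B3" "disjnt B2 B3"
  shows "finite {g \<in> carrier G. \<phi> g ` A1 \<inter> B1 \<noteq> {} \<and> \<phi> g ` A2 \<inter> B2 \<noteq> {} \<and> \<phi> g ` A3 \<inter> B3 \<noteq> {}}"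
proof -
  define K where "K C1 C2 C3 = (\<lambda>x. x ` {..<3}) ` (\<Pi>\<^sub>E i\<in>{..<3}. if i = (0::nat) then C1 else if i = 1 then C2 else C3)"
    for C1 C2 C3 :: "'b set"
  have K: "{a, b, c} \<in> K C1 C2 C3" if "a \<in> C1" "b \<in> C2" "c \<in> C3" for a b c C1 C2 C3
    unfolding K_def
    by (rule image_eqI[of _ _ "\<lambda>i\<in>{..<3}. if i = 0 then a else if i = 1 then b else c"])
       (use that in \<open>auto simp: lessThan_3\<close>)
  have "compactin (theta 3 X) (K A1 A2 A3)" "compactin (theta 3 X) (K B1 B2 B3)"
    unfolding K_def using A B disjnt_sym by (auto intro!: compactin_theta[OF X] simp: less_Suc_eq numeral_3_eq_3 split: if_splits)
  then have "finite {g \<in> carrier G. (\<lambda>A. \<phi> g ` A) ` K A1 A2 A3 \<inter> K B1 B2 B3 \<noteq> {}}"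
    using td unfolding three_discontinuous_def properly_discontinuous_def by blast
  moreover have "{g \<in> carrier G. \<phi> g ` A1 \<inter> B1 \<noteq> {} \<and> \<phi> g ` A2 \<inter> B2 \<noteq> {} \<and> \<phi> g ` A3 \<inter> B3 \<noteq> {}}
     \<subseteq> {g \<in> carrier G. (\<lambda>A. \<phi> g ` A) ` K A1 A2 A3 \<inter> K B1 B2 B3 \<noteq> {}}"
  proof (intro subsetI CollectI conjI)
    fix g assume g: "g \<in> {g \<in> carrier G. \<phi> g ` A1 \<inter> B1 \<noteq> {} \<and> \<phi> g ` A2 \<inter> B2 \<noteq> {} \<and> \<phi> g ` A3 \<inter> B3 \<noteq> {}}"
    then obtain a b c where "a \<in> A1" "b \<in> A2" "c \<in> A3" "\<phi> g a \<in> B1" "\<phi> g b \<in> B2" "\<phi> g c \<in> B3" by auto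
    then have "{a, b, c} \<in> K A1 A2 A3" "\<phi> g ` {a, b, c} \<in> K B1 B2 B3"
      using K[of a A1 b A2 c A3] K[of "\<phi> g a" B1 "\<phi> g b" B2 "\<phi> g c" B3] by simp_all
    then show "(\<lambda>A. \<phi> g ` A) ` K A1 A2 A3 \<inter> K B1 B2 B3 \<noteq> {}" by blast
    show "g \<in> carrier G" using g by simp
  qed
  ultimately show ?thesis by (rule rev_finite_subset)
qed

text \<open>The preimage among ordered pairs is the union of the two boxes obtained by ordering
  \<open>U\<close> and \<open>W\<close> in both ways.\<close>

lemma openin_theta_pairs:
  assumes "openin X U" "openin X W"
  shows "openin (theta 2 X) {A \<in> topspace (theta 2 X). \<exists>a\<in>U. \<exists>b\<in>W. A = {a, b}}" (is "openin _ ?T")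
proof -
  let ?P = "product_topology (\<lambda>_. X) {..<2::nat}"
  let ?Y = "subtopology ?P {x. inj_on x {..<2}}"
  have two: "{..<2::nat} = {0, 1}" by auto
  let ?R = "\<lambda>U W. (\<Pi>\<^sub>E i\<in>{..<2}. if i = (0::nat) then U else W)"
  have R: "openin ?P (?R U W)" "openin ?P (?R W U)"
    using assms by (auto simp: openin_PiE_gen)
  have UW: "U \<subseteq> topspace X" "W \<subseteq> topspace X" using assms openin_subset by auto
  have "{x \<in> topspace ?Y. x ` {..<2} \<in> ?T} = (?R U W \<union> ?R W U) \<inter> {x. inj_on x {..<2}}" (is "?L = ?RR")
  proof (intro Set.set_eqI iffI)
    fix x assume x: "x \<in> ?L"
    then obtain a b where ab: "a \<in> U" "b \<in> W" "{x 0, x 1} = {a, b}" by (auto simp: two)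
    then have "x 0 \<in> U \<and> x 1 \<in> W \<or> x 0 \<in> W \<and> x 1 \<in> U" by (auto simp: doubleton_eq_iff)
    then show "x \<in> ?RR" using x by (auto simp: two PiE_iff)
  next
    fix x assume x: "x \<in> ?RR"
    then have "x 0 \<in> U \<and> x 1 \<in> W \<or> x 0 \<in> W \<and> x 1 \<in> U" by (auto simp: two PiE_iff)
    then have ex: "\<exists>a\<in>U. \<exists>b\<in>W. x ` {..<2} = {a, b}" unfolding two by (auto simp: insert_commute)
    have xY: "x \<in> topspace ?Y" using x UW by (auto simp: two PiE_iff)
    then have "x ` {..<2} \<in> topspace (theta 2 X)" 
      unfolding theta_def topspace_quotient_topology by blast
    then show "x \<in> ?L" using ex xY by blast
  qed
  moreover have "openin ?P (?R U W \<union> ?R W U)" using R by auto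
  ultimately have "openin ?Y {x \<in> topspace ?Y. x ` {..<2} \<in> ?T}"
    by (auto simp: openin_subtopology)
  moreover have "?T \<subseteq> (\<lambda>x. x ` {..<2}) ` topspace ?Y"
    using topspace_quotient_topology[of ?Y "\<lambda>x. x ` {..<2}"] unfolding theta_def by blast
  ultimately show ?thesis unfolding theta_def openin_quotient_topology by blast
qed

text \<open>Orbits of pairs that meet a box \<open>U\<close>, \<open>W\<close> with disjoint
  closures form an open set of the quotient, and by normality these sets cover it. The closures
  belonging to a finite subcover give \<open>P\<close>: up to the group, any two points are apart in
  one of finitely many ways.\<close>

lemma two_cocompact_separation:
  fixes G (structure)
  assumes act: "acts_by_homeos G X \<phi>" and cc: "two_cocompact G X \<phi>"
    and X: "compact_space X" "Hausdorff_space X"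
  shows "\<exists>P. finite P \<and> (\<forall>A B. (A, B) \<in> P \<longrightarrow> closedin X A \<and> closedin X B \<and> disjnt A B) \<and>
    (\<forall>x\<in>topspace X. \<forall>y\<in>topspace X. x \<noteq> y \<longrightarrow>
       (\<exists>g\<in>carrier G. \<exists>A B. (A, B) \<in> P \<and> \<phi> g x \<in> A \<and> \<phi> g y \<in> B))"
proof -
  interpret ga: group_action G "topspace X" \<phi> using act by (simp add: acts_by_homeos_def)
  interpret group G using ga.group_hom group_hom.axioms(1) by auto
  let ?\<Theta> = "theta 2 X" and ?orb = "orbit G (\<lambda>g A. \<phi> g ` A)"
  let ?Q = "quotient_topology ?\<Theta> ?orb"
  define T where "T U W = {A \<in> topspace ?\<Theta>. \<exists>a\<in>U. \<exists>b\<in>W. A = {a, b}}" for U W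
  define O' where "O' = (\<lambda>(U, W). ?orb ` {A \<in> topspace ?\<Theta>. \<exists>g\<in>carrier G. \<phi> g ` A \<in> T U W})"
  define I where "I = {(U, W). openin X U \<and> openin X W \<and> disjnt (X closure_of U) (X closure_of W)}"
  have Asub: "A \<subseteq> topspace X" if "A \<in> topspace ?\<Theta>" for A using that by (simp add: topspace_theta)
  have pair: "\<exists>x y. x \<in> topspace X \<and> y \<in> topspace X \<and> x \<noteq> y \<and> A = {x, y}" if "A \<in> topspace ?\<Theta>" for A
    using that by (auto simp: topspace_theta card_2_iff)
  have pairI: "{x, y} \<in> topspace ?\<Theta>" if "x \<in> topspace X" "y \<in> topspace X" "x \<noteq> y" for x y
    using that by (auto simp: topspace_theta)
  have one: "\<phi> \<one> x = x" if "x \<in> topspace X" for x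
    using ga.id_eq_one that by (metis restrict_apply')
  have self: "A \<in> ?orb A" if "A \<in> topspace ?\<Theta>" for A
  proof -
    have "\<phi> \<one> ` A = A" using one Asub[OF that] by force
    then show ?thesis unfolding orbit_def by force
  qed
  have orbD: "\<exists>k\<in>carrier G. A = \<phi> k ` A'" if "?orb A = ?orb A'" "A \<in> topspace ?\<Theta>" for A A'
    using self[OF that(2)] that(1) unfolding orbit_def by auto
  have comp: "\<phi> g ` \<phi> k ` A = \<phi> (g \<otimes> k) ` A"
    if "A \<in> topspace ?\<Theta>" "g \<in> carrier G" "k \<in> carrier G" for A g k
    using ga.composition_rule[OF _ that(2,3)] Asub[OF that(1)] unfolding image_image by (intro image_cong) auto
  have "openin ?Q (O' UW)" if UWI: "UW \<in> I" for UW
  proof -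
    obtain U W where UW: "UW = (U, W)" "openin X U" "openin X W" using UWI by (auto simp: I_def)
    define pre where "pre g C = {x \<in> topspace X. \<phi> g x \<in> C}" for g C
    have pre: "openin X (pre g C)" if "g \<in> carrier G" "openin X C" for g C
      using act that unfolding acts_by_homeos_def pre_def
      by (metis homeomorphic_imp_continuous_map openin_continuous_map_preimage)
    \<comment> \<open>Openness in the quotient is openness of this preimage, which is a union of
      translated boxes.\<close>
    have "{A \<in> topspace ?\<Theta>. ?orb A \<in> O' UW} = (\<Union>g\<in>carrier G. T (pre g U) (pre g W))" (is "?L = ?R")
    proof (intro Set.set_eqI iffI)
      fix A assume A: "A \<in> ?L"
      then obtain A' g where A': "A' \<in> topspace ?\<Theta>" "?orb A = ?orb A'" "g \<in> carrier G" "\<phi> g ` A' \<in> T U W"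
        unfolding UW O'_def by auto
      obtain k where k: "k \<in> carrier G" "A' = \<phi> k ` A" using orbD[OF A'(2)[symmetric] A'(1)] by blast
      then have "\<phi> (g \<otimes> k) ` A \<in> T U W" using A' A comp[of A g k] by simp
      then obtain a b where ab: "a \<in> U" "b \<in> W" "\<phi> (g \<otimes> k) ` A = {a, b}" by (auto simp: T_def)
      obtain x y where xy: "x \<in> topspace X" "y \<in> topspace X" "x \<noteq> y" "A = {x, y}" using A pair[of A] by blast
      have "x \<in> pre (g \<otimes> k) U \<and> y \<in> pre (g \<otimes> k) W \<or> x \<in> pre (g \<otimes> k) W \<and> y \<in> pre (g \<otimes> k) U"
        using ab xy by (auto simp: pre_def doubleton_eq_iff)
      then have "A \<in> T (pre (g \<otimes> k) U) (pre (g \<otimes> k) W)" using A xy(4) by (auto simp: T_def insert_commute)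
      then show "A \<in> ?R" using A' k by blast
    next
      fix A assume "A \<in> ?R"
      then obtain g x y where g: "g \<in> carrier G" "A \<in> topspace ?\<Theta>" "x \<in> pre g U" "y \<in> pre g W" "A = {x, y}"
        by (auto simp: T_def)
      have "x \<noteq> y" using g by (auto simp: topspace_theta)
      then have "\<phi> g x \<noteq> \<phi> g y" using ga.inj_prop[OF g(1)] g by (auto simp: pre_def inj_on_def)
      then have "\<phi> g ` A \<in> topspace ?\<Theta>"
        using g ga.element_image[OF g(1)] by (auto intro!: pairI simp: pre_def)
      then have "\<phi> g ` A \<in> T U W" using g by (auto simp: T_def pre_def)
      then show "A \<in> ?L" using g(1,2) unfolding UW O'_def prod.case by blast
    qed
    moreover have "openin ?\<Theta> ?R"
      using UW pre unfolding T_def by (auto intro!: openin_theta_pairs)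
    moreover have "O' UW \<subseteq> ?orb ` topspace ?\<Theta>" unfolding UW O'_def by auto
    ultimately show ?thesis by (simp add: openin_quotient_topology)
  qed
  moreover have "topspace ?Q \<subseteq> \<Union> (O' ` I)"
  proof
    fix z assume "z \<in> topspace ?Q"
    then obtain A where A: "A \<in> topspace ?\<Theta>" "z = ?orb A" by (auto simp: topspace_quotient_topology)
    obtain x y where xy: "x \<in> topspace X" "y \<in> topspace X" "x \<noteq> y" "A = {x, y}" using A pair[of A] by blast
    have "closedin X {x}" "closedin X {y}" "disjnt {x} {y}"
      using xy X(2) by (auto simp: closedin_Hausdorff_singleton)
    then obtain U W where UW: "openin X U" "openin X W" "{x} \<subseteq> U" "{y} \<subseteq> W" "disjnt (X closure_of U) (X closure_of W)"
      using compact_Hausdorff_or_regular_imp_normal_space[OF X(1)] X(2) unfolding normal_space_disjoint_closures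
      by meson
    have "\<phi> \<one> ` A \<in> T U W" using xy UW A one by (auto simp: T_def insert_commute)
    then have "z \<in> O' (U, W)" using A one_closed unfolding O'_def prod.case by blast
    then show "z \<in> \<Union> (O' ` I)" using UW by (auto simp: I_def)
  qed
  ultimately obtain \<F> where "finite \<F>" "\<F> \<subseteq> O' ` I" "topspace ?Q \<subseteq> \<Union>\<F>"
    using cc unfolding two_cocompact_def compact_space_alt by (metis (no_types, lifting) imageE)
  then obtain J where J: "J \<subseteq> I" "finite J" "topspace ?Q \<subseteq> \<Union> (O' ` J)"
    by (metis finite_subset_image)
  \<comment> \<open>Pairs in the quotient are unordered, whereas \<open>P\<close> must respect the
    order of \<open>x\<close> and \<open>y\<close>; so both orders of each pair of closures are
    included.\<close>
  define P where "P = (\<lambda>(U, W). (X closure_of U, X closure_of W)) ` J \<union> (\<lambda>(U, W). (X closure_of W, X closure_of U)) ` J"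
  have "closedin X A \<and> closedin X B \<and> disjnt A B" if "(A, B) \<in> P" for A B
    using that J disjnt_sym by (fastforce simp: P_def I_def)
  moreover have "\<exists>g\<in>carrier G. \<exists>A B. (A, B) \<in> P \<and> \<phi> g x \<in> A \<and> \<phi> g y \<in> B"
    if xy: "x \<in> topspace X" "y \<in> topspace X" "x \<noteq> y" for x y
  proof -
    have "?orb {x, y} \<in> topspace ?Q" using pairI[OF xy] by (auto simp: topspace_quotient_topology)
    then obtain U W where UW: "(U, W) \<in> J" "?orb {x, y} \<in> O' (U, W)" using J by fastforce
    then obtain A g where A: "A \<in> topspace ?\<Theta>" "?orb {x, y} = ?orb A" "g \<in> carrier G" "\<phi> g ` A \<in> T U W"
      unfolding O'_def by auto
    obtain k where k: "k \<in> carrier G" "A = \<phi> k ` {x, y}" using orbD[OF A(2)[symmetric] A(1)] by blast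
    then have "\<phi> (g \<otimes> k) ` {x, y} \<in> T U W" using A comp[OF pairI[OF xy] A(3) k(1)] by simp
    then obtain a b where ab: "a \<in> U" "b \<in> W" "\<phi> (g \<otimes> k) ` {x, y} = {a, b}" by (auto simp: T_def)
    have "openin X U" "openin X W" using UW J by (auto simp: I_def)
    then have cl: "U \<subseteq> X closure_of U" "W \<subseteq> X closure_of W" by (auto intro!: closure_of_subset openin_subset)
    have "\<phi> (g \<otimes> k) x \<in> U \<and> \<phi> (g \<otimes> k) y \<in> W \<or> \<phi> (g \<otimes> k) x \<in> W \<and> \<phi> (g \<otimes> k) y \<in> U"
      using ab by (auto simp: doubleton_eq_iff)
    moreover have "(X closure_of U, X closure_of W) \<in> P" "(X closure_of W, X closure_of U) \<in> P"
      using UW by (force simp: P_def)+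
    ultimately show ?thesis using cl A(3) k(1) m_closed by blast
  qed
  moreover have "finite P" using J by (simp add: P_def)
  ultimately show ?thesis by (intro exI[of _ P]) simp
qed

section \<open>Limits in the completion\<close>

context Metric_space
begin


lemma topspace_completion: "topspace (completion_topology M d) = cauchy_completion M d"
  by (simp add: completion_topology_def Metric_space.topspace_mtopology[OF Metric_space_completion])

lemma completion_limit_iff:
  "limitin (completion_topology M d) s a sequentially \<longleftrightarrow>
    a \<in> cauchy_completion M d \<and> (\<forall>\<^sub>F n in sequentially. s n \<in> cauchy_completion M d) \<and>
    (\<lambda>n. completion_dist M d (s n) a) \<longlonglongrightarrow> 0"
  unfolding completion_topology_def
  by (rule Metric_space.limitin_metric_dist_null[OF Metric_space_completion])

lemma Hausdorff_completion: "Hausdorff_space (completion_topology M d)"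
  unfolding completion_topology_def
  by (rule Metric_space.Hausdorff_space_mtopology[OF Metric_space_completion])

lemma completion_dist_embed_class:
  assumes "x \<in> M" "MCauchy s"
  shows "(\<lambda>n. d x (s n)) \<longlonglongrightarrow> completion_dist M d (completion_embed M d x) (cauchy_equiv M d `` {s})"
proof -
  have "(\<lambda>_. x) \<in> completion_embed M d x" "s \<in> cauchy_equiv M d `` {s}"
    using MCauchy_const[OF assms(1)] assms(2) equiv_class_self[OF equiv_cauchy_equiv]
    by (auto simp: completion_embed_def)
  moreover have "cauchy_equiv M d `` {s} \<in> cauchy_completion M d"
    using assms(2) unfolding cauchy_completion_def by (auto intro: quotientI)
  ultimately show ?thesis using completion_dist_tendsto completion_embed_in[OF assms(1)] by blast
qed

lemma Cauchy_limit_class: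
  assumes s: "MCauchy s"
  shows "limitin (completion_topology M d) (\<lambda>n. completion_embed M d (s n)) (cauchy_equiv M d `` {s}) sequentially"
proof -
  interpret C: Metric_space "cauchy_completion M d" "completion_dist M d" by (rule Metric_space_completion)
  let ?a = "cauchy_equiv M d `` {s}"
  have a: "?a \<in> cauchy_completion M d"
    using s unfolding cauchy_completion_def by (auto intro: quotientI)
  have sM: "s n \<in> M" for n using s by (auto simp: MCauchy_def)
  have "(\<lambda>n. completion_dist M d (completion_embed M d (s n)) ?a) \<longlonglongrightarrow> 0"
  proof (rule LIMSEQ_I)
    fix e :: real assume "e > 0"
    then obtain N where N: "\<And>n n'. N \<le> n \<Longrightarrow> N \<le> n' \<Longrightarrow> d (s n) (s n') < e / 2"
      using s half_gt_zero[of e] unfolding MCauchy_def by meson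
    have "completion_dist M d (completion_embed M d (s n)) ?a \<le> e / 2" if "N \<le> n" for n
      by (rule LIMSEQ_le_const2[OF completion_dist_embed_class[OF sM s]])
         (use N[OF that] in \<open>auto intro!: exI[of _ N] less_imp_le\<close>)
    then show "\<exists>N. \<forall>n\<ge>N. norm (completion_dist M d (completion_embed M d (s n)) ?a - 0) < e"
      using \<open>e > 0\<close> by (intro exI[of _ N]) fastforce
  qed
  then show ?thesis using a sM completion_embed_in by (simp add: completion_limit_iff)
qed

lemma completion_obtain_seq:
  assumes "a \<in> cauchy_completion M d"
  obtains s where "MCauchy s" "a = cauchy_equiv M d `` {s}"
  using assms unfolding cauchy_completion_def by (auto elim: quotientE)

lemma completion_limit_shift:
  assumes s: "limitin (completion_topology M d) (\<lambda>n. completion_embed M d (s n)) a sequentially"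
    and M: "\<And>n. s n \<in> M" "\<And>n. t n \<in> M" and st: "(\<lambda>n. d (s n) (t n)) \<longlonglongrightarrow> 0"
  shows "limitin (completion_topology M d) (\<lambda>n. completion_embed M d (t n)) a sequentially"
proof -
  interpret C: Metric_space "cauchy_completion M d" "completion_dist M d" by (rule Metric_space_completion)
  have a: "a \<in> cauchy_completion M d" using s by (simp add: completion_limit_iff)
  have l1: "(\<lambda>n. d (s n) (t n) + completion_dist M d (completion_embed M d (s n)) a) \<longlonglongrightarrow> 0 + 0"
    using s st by (intro tendsto_add) (simp_all add: completion_limit_iff)
  have l2: "completion_dist M d (completion_embed M d (t n)) a
      \<le> d (s n) (t n) + completion_dist M d (completion_embed M d (s n)) a" for n
    using C.triangle[OF completion_embed_in[OF M(2)] completion_embed_in[OF M(1)] a, of n n]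
    unfolding completion_dist_embed[OF M(2) M(1)] commute[of "t n" "s n"] .
  have "(\<lambda>n. completion_dist M d (completion_embed M d (t n)) a) \<longlonglongrightarrow> 0"
    by (rule tendsto_sandwich[OF always_eventually always_eventually tendsto_const l1[simplified]])
       (use l2 in auto)
  then show ?thesis using a M completion_embed_in by (simp add: completion_limit_iff)
qed

text \<open>A Cauchy sequence that represents a point of the \<open>e\<close>-ball around
  \<open>x\<close> is eventually equal to \<open>x\<close>, so isolation survives
  completion.\<close>

lemma completion_isolated:
  assumes x: "x \<in> M" and e: "e > 0" "\<And>y. y \<in> M \<Longrightarrow> y \<noteq> x \<Longrightarrow> e \<le> d x y"
  shows "openin (completion_topology M d) {completion_embed M d x}"
proof -
  interpret C: Metric_space "cauchy_completion M d" "completion_dist M d" by (rule Metric_space_completion)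
  have "C.mball (completion_embed M d x) e = {completion_embed M d x}"
  proof (intro subset_antisym subsetI)
    fix a assume a: "a \<in> C.mball (completion_embed M d x) e"
    then obtain s where s: "MCauchy s" "a = cauchy_equiv M d `` {s}"
      using completion_obtain_seq by auto
    have "(\<lambda>n. d x (s n)) \<longlonglongrightarrow> completion_dist M d (completion_embed M d x) a"
      using completion_dist_embed_class[OF x s(1)] s by simp
    moreover from this have "\<forall>\<^sub>F n in sequentially. d x (s n) < e"
      by (rule order_tendstoD(2)) (use a in simp)
    then have "\<forall>\<^sub>F n in sequentially. d x (s n) = 0"
    proof (rule eventually_mono)
      fix n assume "d x (s n) < e"
      then have "s n = x" using e(2)[of "s n"] s(1) unfolding MCauchy_def by (meson linorder_not_le rangeI subsetD)
      then show "d x (s n) = 0" using x by simp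
    qed
    then have "(\<lambda>n. d x (s n)) \<longlonglongrightarrow> 0" by (rule tendsto_eventually)
    ultimately have "completion_dist M d (completion_embed M d x) a = 0" using LIMSEQ_unique by blast
    then show "a \<in> {completion_embed M d x}" using a by auto
  qed (use x e completion_embed_in in auto)
  then show ?thesis unfolding completion_topology_def by (metis C.openin_mball)
qed

text \<open>A finite set of embedded points is closed, so its complement is a neighbourhood of a
  limit that is not an embedded point.\<close>

lemma completion_limit_leaves_finite:
  assumes "limitin (completion_topology M d) (\<lambda>n. completion_embed M d (s n)) a sequentially"
    and M: "\<And>n. s n \<in> M" and a: "a \<notin> completion_embed M d ` M" and K: "finite K"
  shows "\<forall>\<^sub>F n in sequentially. s n \<notin> K"
proof -
  let ?K = "completion_embed M d ` (K \<inter> M)"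
  have "closedin (completion_topology M d) ?K"
    using K Hausdorff_completion completion_embed_in
    by (intro closedin_Hausdorff_finite) (auto simp: topspace_completion)
  then have "openin (completion_topology M d) (topspace (completion_topology M d) - ?K)"
    by (rule openin_diff[OF openin_topspace])
  moreover have "a \<in> topspace (completion_topology M d) - ?K"
    using limitin_topspace[OF assms(1)] a by blast
  ultimately have "\<forall>\<^sub>F n in sequentially. completion_embed M d (s n) \<in> topspace (completion_topology M d) - ?K"
    using assms(1) unfolding limitin_def by blast
  then show ?thesis by (rule eventually_mono) (use M in auto)
qed

lemma completion_limit_infinite_range:
  assumes "limitin (completion_topology M d) (\<lambda>n. completion_embed M d (s n)) a sequentially"
    and "\<And>n. s n \<in> M" "a \<notin> completion_embed M d ` M"
  shows "infinite (range s)"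
  using completion_limit_leaves_finite[OF assms, of "range s"] by auto

end

section \<open>Points that are both ends of a geodesic\<close>

locale floyd_graph_action = cayley G S for G (structure) and S +
  fixes X :: "'x topology" and \<phi> :: "'a \<Rightarrow> 'x \<Rightarrow> 'x" and lam :: real
    and V :: "'v set" and E :: "'v set set" and \<rho> :: "'a \<Rightarrow> 'v \<Rightarrow> 'v"
    and M :: "('x + 'v) topology" and \<psi> :: "'a \<Rightarrow> 'v"
    and \<Psi> :: "(nat \<Rightarrow> 'a) set \<Rightarrow> 'x + 'v" and F\<^sub>0 :: "(nat \<Rightarrow> 'a) set \<Rightarrow> 'x"
  assumes X: "compact_space X" "Hausdorff_space X" and actX: "acts_by_homeos G X \<phi>"
    and cocomp: "two_cocompact G X \<phi>" and lam: "0 < lam" "lam < 1"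
    and exp: "exponential_floyd_map G S X \<phi> lam V E \<rho> M \<psi> \<Psi> F\<^sub>0"
begin

abbreviation "act \<equiv> sum_action M \<phi> \<rho>"

abbreviation vx :: "'a \<Rightarrow> 'x + 'v" where "vx g \<equiv> Inr (\<psi> g)"

lemmas exp_parts = exp[unfolded exponential_floyd_map_def]

lemma sumM: "compact_sum_topology X V M" using exp_parts by blast
lemma actM: "acts_by_homeos G M act" using exp_parts by blast
lemma tdM: "three_discontinuous G M act" using exp_parts by blast
lemma M: "compact_space M" "Hausdorff_space M" "topspace M = Inl ` topspace X \<union> Inr ` V"
  using sumM by (auto simp: compact_sum_topology_def)

sublocale XA: group_action G "topspace X" \<phi> using actX by (simp add: acts_by_homeos_def)
sublocale MA: group_action G "topspace M" act using actM by (simp add: acts_by_homeos_def)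

lemma vx_in: "g \<in> carrier G \<Longrightarrow> vx g \<in> topspace M"
  using exp_parts M(3) by blast

lemma Inl_in: "x \<in> topspace X \<Longrightarrow> Inl x \<in> topspace M"
  using M(3) by blast

lemma act_vx: "g \<in> carrier G \<Longrightarrow> h \<in> carrier G \<Longrightarrow> act g (vx h) = vx (g \<otimes> h)"
  using vx_in[of h] exp_parts by (simp add: sum_action_def)

lemma act_Inl: "x \<in> topspace X \<Longrightarrow> act g (Inl x) = Inl (\<phi> g x)"
  using Inl_in[of x] by (simp add: sum_action_def)

lemma act_preimage_open:
  assumes "g \<in> carrier G" "openin M U"
  shows "openin M {m \<in> topspace M. act g m \<in> U}"
  using actM assms unfolding acts_by_homeos_def
  by (metis homeomorphic_imp_continuous_map openin_continuous_map_preimage)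

lemma Inl_continuous: "continuous_map X M Inl"
  using sumM unfolding compact_sum_topology_def embedding_map_def
  by (metis continuous_map_in_subtopology homeomorphic_imp_continuous_map)

lemma Inl_closed: "closedin X A \<Longrightarrow> closedin M (Inl ` A)"
  using closedin_compact_space[OF X(1)] image_compactin[OF _ Inl_continuous] compactin_imp_closedin[OF M(2)]
  by blast

lemma Inl_preimage_open: "openin M U \<Longrightarrow> openin X {x \<in> topspace X. Inl x \<in> U}"
  using openin_continuous_map_preimage[OF Inl_continuous] .

text \<open>The embedding only makes a vertex open among the vertices; these form an open subset of
  \<open>M\<close> because the copy of \<open>X\<close> is compact, hence closed.\<close>

lemma vx_open: 
  assumes "g \<in> carrier G" shows "openin M {vx g}"
proof -
  have V: "\<psi> g \<in> V" using exp_parts assms by blast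
  have emb: "embedding_map (discrete_topology V) M Inr" using sumM by (simp add: compact_sum_topology_def)
  then have "open_map (discrete_topology V) (subtopology M (Inr ` V)) Inr"
    unfolding embedding_map_def using homeomorphic_imp_open_map by fastforce
  then have "openin (subtopology M (Inr ` V)) (Inr ` {\<psi> g})"
    unfolding open_map_def using V by (meson empty_subsetI insert_subset openin_discrete_topology)
  then obtain T where T: "openin M T" "{vx g} = T \<inter> Inr ` V" by (auto simp: openin_subtopology)
  have "Inr ` V = topspace M - Inl ` topspace X" using M(3) by auto
  moreover have "openin M (topspace M - Inl ` topspace X)"
    using Inl_closed[OF closedin_topspace] by (rule openin_diff[OF openin_topspace])
  ultimately show ?thesis using T by (metis openin_Int)
qed

lemma vx_closed: "g \<in> carrier G \<Longrightarrow> closedin M {vx g}"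
  using closedin_Hausdorff_singleton[OF M(2) vx_in] .

lemma separation:
  assumes "closedin M A" "closedin M B" "disjnt A B"
  obtains U W where "openin M U" "openin M W" "A \<subseteq> U" "B \<subseteq> W" "disjnt (M closure_of U) (M closure_of W)"
  using compact_Hausdorff_or_regular_imp_normal_space[OF M(1)] M(2) assms
  unfolding normal_space_disjoint_closures by meson

lemma point_separation:
  assumes "x \<in> topspace X" "y \<in> topspace X" "x \<noteq> y"
  obtains U W where "openin M U" "openin M W" "Inl x \<in> U" "Inl y \<in> W" "disjnt (M closure_of U) (M closure_of W)"
proof -
  have "closedin M {Inl x}" "closedin M {Inl y}" "disjnt {Inl x} {Inl y :: 'x + 'v}"
    using assms closedin_Hausdorff_singleton[OF M(2) Inl_in] by auto
  then show thesis using that separation by (metis insert_subset)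
qed

lemma shrink:
  assumes "x \<in> topspace X" "openin M U" "Inl x \<in> U"
  obtains W where "openin M W" "Inl x \<in> W" "M closure_of W \<subseteq> U"
proof -
  have "closedin M {Inl x}" using assms(1) closedin_Hausdorff_singleton[OF M(2) Inl_in] by auto
  moreover have "closedin M (topspace M - U)" using assms(2) by blast
  ultimately obtain W W' where W: "openin M W" "openin M W'" "{Inl x} \<subseteq> W" "topspace M - U \<subseteq> W'"
      "disjnt (M closure_of W) (M closure_of W')"
    using assms(3) separation[of "{Inl x}" "topspace M - U"] by (auto simp: disjnt_iff)
  have "W' \<subseteq> M closure_of W'" by (rule closure_of_subset[OF openin_subset[OF W(2)]])
  then have "M closure_of W \<subseteq> U"
    using W(4,5) closure_of_subset_topspace[of M W] by (auto simp: disjnt_iff)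
  then show thesis using that W(1,3) by blast
qed

text \<open>On a fibre the graph distance of the images is zero, so the lower quasi-isometry bound
  leaves \<open>wd g h \<le> c * c\<close>.\<close>

lemma finite_fiber: "finite {h \<in> carrier G. \<psi> h = \<psi> g}" if g: "g \<in> carrier G"
proof -
  obtain c :: real where c: "c \<ge> 1"
    and qi: "\<And>x y. x \<in> carrier G \<Longrightarrow> y \<in> carrier G \<Longrightarrow> wd x y / c - c \<le> graph_dist E (\<psi> x) (\<psi> y)"
    using exp_parts unfolding quasi_isometric_map_def by blast
  have "{h \<in> carrier G. \<psi> h = \<psi> g} \<subseteq> {h \<in> carrier G. wlen h \<le> wlen g + nat \<lceil>c * c\<rceil>}"
  proof (intro subsetI CollectI)
    fix h assume h: "h \<in> {h \<in> carrier G. \<psi> h = \<psi> g}"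
    then have "wd g h / c - c \<le> 0" using qi[of g h] g by simp
    then have "real (wd g h) \<le> c * c" using c by (simp add: field_simps)
    then have "wd g h \<le> nat \<lceil>c * c\<rceil>" by linarith
    then show "h \<in> carrier G \<and> wlen h \<le> wlen g + nat \<lceil>c * c\<rceil>"
      using h g dist_triangle[of \<one> g h] by auto
  qed
  then show ?thesis using finite_wball by (rule finite_subset)
qed

section \<open>Geodesics seen in the compact space \<open>M\<close>\<close>

abbreviation "f0 \<equiv> (\<lambda>n. lam ^ n)"

lemma f0: "floyd_function f0" using lam by (rule floyd_function_power)

text \<open>Otherwise vertices in \<open>A\<close> and in \<open>C\<close> come from elements at
  Floyd distance tending to zero. A subsequence makes both sequences converge to one point of the
  completion, and \<open>\<Psi>\<close> would send that point into \<open>A\<close> and into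
  \<open>C\<close>.\<close>

lemma floyd_separation:
  assumes "closedin M A" "closedin M C" "disjnt A C"
  shows "\<exists>e>0. \<forall>x\<in>carrier G. \<forall>y\<in>carrier G. vx x \<in> A \<longrightarrow> vx y \<in> C \<longrightarrow> e \<le> fd f0 x y"
proof (rule ccontr)
  interpret D: Metric_space "carrier G" "fd f0" by (rule Metric_space_fd[OF f0])
  assume "\<not> ?thesis"
  then have "\<exists>x\<in>carrier G. \<exists>y\<in>carrier G. vx x \<in> A \<and> vx y \<in> C \<and> fd f0 x y < inverse (real (Suc n))" for n
    by (metis inverse_positive_iff_positive linorder_not_le of_nat_0_less_iff zero_less_Suc)
  then obtain x y where xy: "\<And>n. x n \<in> carrier G" "\<And>n. y n \<in> carrier G" "\<And>n. vx (x n) \<in> A" "\<And>n. vx (y n) \<in> C"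
    "\<And>n. fd f0 (x n) (y n) < inverse (real (Suc n))" by metis
  obtain r where r: "strict_mono r" "D.MCauchy (x \<circ> r)"
    using fd_totally_bounded[OF f0] xy(1) unfolding D.mtotally_bounded_sequentially by blast
  let ?a = "cauchy_equiv (carrier G) (fd f0) `` {x \<circ> r}"
  let ?CT = "completion_topology (carrier G) (fd f0)" and ?emb = "completion_embed (carrier G) (fd f0)"
  have lx: "limitin ?CT (\<lambda>n. ?emb ((x \<circ> r) n)) ?a sequentially" by (rule D.Cauchy_limit_class[OF r(2)])
  have "(\<lambda>n. fd f0 (x n) (y n)) \<longlonglongrightarrow> 0"
    by (rule tendsto_sandwich[OF always_eventually always_eventually tendsto_const LIMSEQ_inverse_real_of_nat])
       (use xy(5) less_imp_le in auto)
  then have "(\<lambda>n. fd f0 ((x \<circ> r) n) ((y \<circ> r) n)) \<longlonglongrightarrow> 0"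
    using LIMSEQ_subseq_LIMSEQ[OF _ r(1)] by (fastforce simp: o_def)
  then have ly: "limitin ?CT (\<lambda>n. ?emb ((y \<circ> r) n)) ?a sequentially"
    using D.completion_limit_shift[OF lx] xy(1,2) by simp
  have cont: "continuous_map ?CT M \<Psi>" using exp_parts unfolding floyd_completion_def by blast
  have Pe: "\<Psi> (?emb g) = vx g" if "g \<in> carrier G" for g
    using exp_parts that unfolding floyd_embed_def by blast
  have "limitin M (\<lambda>n. vx (x (r n))) (\<Psi> ?a) sequentially"
    using continuous_map_limit[OF cont lx] Pe[OF xy(1)] by (simp add: o_def)
  then have "\<Psi> ?a \<in> A" by (rule limitin_closedin[OF _ assms(1)]) (use xy in auto)
  moreover have "limitin M (\<lambda>n. vx (y (r n))) (\<Psi> ?a) sequentially"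
    using continuous_map_limit[OF cont ly] Pe[OF xy(2)] by (simp add: o_def)
  then have "\<Psi> ?a \<in> C" by (rule limitin_closedin[OF _ assms(2)]) (use xy in auto)
  ultimately show False using assms(3) by (auto simp: disjnt_iff)
qed

text \<open>A geodesic that starts and ends in \<open>A\<close> and visits \<open>C\<close> at \<open>g\<close> passes near the identity both
  before and after \<open>g\<close>, and between these two visits it has bounded length.\<close>

lemma finite_between:
  assumes "closedin M A" "closedin M C" "disjnt A C"
  shows "finite {g \<in> carrier G. vx g \<in> C \<and> (\<exists>x y. between x g y \<and> vx x \<in> A \<and> vx y \<in> A)}"
proof -
  obtain e where e: "e > 0" "\<And>x y. x \<in> carrier G \<Longrightarrow> y \<in> carrier G \<Longrightarrow> vx x \<in> A \<Longrightarrow> vx y \<in> C \<Longrightarrow> e \<le> fd f0 x y"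
    using floyd_separation[OF assms] by blast
  obtain R where R: "\<And>x y. x \<in> carrier G \<Longrightarrow> y \<in> carrier G \<Longrightarrow> e \<le> fd f0 x y \<Longrightarrow> \<exists>u. between x u y \<and> wlen u \<le> R"
    using karlsson[OF f0 e(1)] by blast
  have "wlen g \<le> 3 * R" if g: "g \<in> carrier G" "vx g \<in> C" "between x g y" "vx x \<in> A" "vx y \<in> A" for g x y
  proof -
    have G: "x \<in> carrier G" "y \<in> carrier G" using g by (auto simp: between_def)
    obtain s where s: "between x s g" "wlen s \<le> R" using R[OF G(1) g(1)] e(2) G g by blast
    obtain t where t: "between y t g" "wlen t \<le> R" using R[OF G(2) g(1)] e(2) G g by blast
    have st: "s \<in> carrier G" "t \<in> carrier G" using s t by (auto simp: between_def)
    \<comment> \<open>The order along the geodesic is \<open>x\<close>, \<open>s\<close>,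
      \<open>g\<close>, \<open>t\<close>, \<open>y\<close>, so
      \<open>wd s g + wd g t \<le> wd s t \<le> 2 * R\<close>; a further \<open>R\<close> leads from
      the identity to \<open>s\<close>.\<close>
    have "wd x y \<le> wd x s + wd s y" "wd s y \<le> wd s t + wd t y" "wd s t \<le> wd s \<one> + wlen t"
      "wlen g \<le> wlen s + wd s g"
      using dist_triangle G st g(1) by auto
    moreover have "wd x g + wd g y = wd x y" "wd x s + wd s g = wd x g" "wd y t + wd t g = wd y g"
      using g s t by (auto simp: between_def)
    ultimately show ?thesis
      using s(2) t(2) graph_dist_commute[of _ s \<one>] graph_dist_commute[of _ y t] graph_dist_commute[of _ y g] by simp
  qed
  then have "{g \<in> carrier G. vx g \<in> C \<and> (\<exists>x y. between x g y \<and> vx x \<in> A \<and> vx y \<in> A)}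
      \<subseteq> {g \<in> carrier G. wlen g \<le> 3 * R}" by blast
  then show ?thesis using finite_wball by (rule finite_subset)
qed

text \<open>This replaces a bi-infinite geodesic through \<open>g\<close> with both ends at \<open>q\<close>.\<close>

definition horocyclic :: "'x \<Rightarrow> 'a \<Rightarrow> bool" where
  "horocyclic q g \<longleftrightarrow> (\<forall>U. openin M U \<and> Inl q \<in> U \<longrightarrow> (\<exists>x y. between x g y \<and> vx x \<in> U \<and> vx y \<in> U))"

lemma horocyclic_mult:
  assumes k: "k \<in> carrier G" and q: "q \<in> topspace X" and h: "horocyclic q g"
  shows "horocyclic (\<phi> k q) (k \<otimes> g)"
  unfolding horocyclic_def
proof (intro allI impI)
  fix U assume U: "openin M U \<and> Inl (\<phi> k q) \<in> U"
  have "openin M {m \<in> topspace M. act k m \<in> U}" "Inl q \<in> {m \<in> topspace M. act k m \<in> U}"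
    using act_preimage_open[OF k] U Inl_in[OF q] act_Inl[OF q] by auto
  then obtain x y where xy: "between x g y" "act k (vx x) \<in> U" "act k (vx y) \<in> U"
    using h unfolding horocyclic_def by blast
  have "between (k \<otimes> x) (k \<otimes> g) (k \<otimes> y)" by (rule between_mult[OF k xy(1)])
  moreover have "x \<in> carrier G" "y \<in> carrier G" using xy(1) by (auto simp: between_def)
  ultimately show "\<exists>x y. between x (k \<otimes> g) y \<and> vx x \<in> U \<and> vx y \<in> U"
    using xy(2,3) k by (auto simp: act_vx)
qed

text \<open>By equivariance, \<open>g\<close> is horocyclic for \<open>p\<close> exactly if
  \<open>inv g\<close> moves \<open>p\<close> into this set. Its finiteness therefore bounds the
  horocyclic elements modulo the stabilizer.\<close>

definition horo_points :: "'x set" where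
  "horo_points = {q \<in> topspace X. horocyclic q \<one>}"

lemma finite_horo_pairs:
  assumes "closedin M A" "closedin M B" "disjnt A B"
  shows "finite {g \<in> carrier G. (\<exists>q\<in>horo_points. Inl (\<phi> g q) \<in> A) \<and> (\<exists>q\<in>horo_points. Inl (\<phi> g q) \<in> B)}"
proof -
  obtain U W where UW: "openin M U" "openin M W" "A \<subseteq> U" "B \<subseteq> W" "disjnt (M closure_of U) (M closure_of W)"
    using separation[OF assms] .
  \<comment> \<open>A second layer makes the dichotomy on \<open>vx g\<close> fit
    \<open>finite_between\<close>: outside \<open>U'\<close> the vertex avoids the closure of
    \<open>U\<close>, where the ends near \<open>g q\<close> lie; inside \<open>U'\<close> it avoids
    the closure of \<open>W\<close>, where the ends near \<open>g q'\<close> lie.\<close>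
  obtain U' W' where UW': "openin M U'" "openin M W'" "M closure_of U \<subseteq> U'" "M closure_of W \<subseteq> W'"
      "disjnt (M closure_of U') (M closure_of W')"
    using separation[OF closedin_closure_of closedin_closure_of UW(5)] .
  have sub: "D \<subseteq> M closure_of D" if "openin M D" for D using closure_of_subset[OF openin_subset[OF that]] .
  define K where "K A C = {g \<in> carrier G. vx g \<in> C \<and> (\<exists>x y. between x g y \<and> vx x \<in> A \<and> vx y \<in> A)}" for A C
  have "finite (K (M closure_of U) (topspace M - U'))"
    unfolding K_def using UW'(1,3) by (intro finite_between) (auto simp: disjnt_iff)
  moreover have "finite (K (M closure_of W) (M closure_of U'))"
    unfolding K_def using UW'(2,4,5) sub[OF UW'(2)] by (intro finite_between) (auto simp: disjnt_iff)
  moreover have near: "\<exists>x y. between x g y \<and> vx x \<in> M closure_of D \<and> vx y \<in> M closure_of D"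
    if "g \<in> carrier G" "q \<in> horo_points" "Inl (\<phi> g q) \<in> D" "openin M D" for g q D
  proof -
    have "horocyclic (\<phi> g q) (g \<otimes> \<one>)" using that by (intro horocyclic_mult) (auto simp: horo_points_def)
    then show ?thesis using that sub[OF that(4)] unfolding horocyclic_def by fastforce
  qed
  have "{g \<in> carrier G. (\<exists>q\<in>horo_points. Inl (\<phi> g q) \<in> A) \<and> (\<exists>q\<in>horo_points. Inl (\<phi> g q) \<in> B)}
      \<subseteq> K (M closure_of U) (topspace M - U') \<union> K (M closure_of W) (M closure_of U')"
  proof
    fix g assume g: "g \<in> {g \<in> carrier G. (\<exists>q\<in>horo_points. Inl (\<phi> g q) \<in> A) \<and> (\<exists>q\<in>horo_points. Inl (\<phi> g q) \<in> B)}"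
    then obtain q q' where q: "g \<in> carrier G" "q \<in> horo_points" "Inl (\<phi> g q) \<in> U" "q' \<in> horo_points" "Inl (\<phi> g q') \<in> W"
      using UW(3,4) by blast
    show "g \<in> K (M closure_of U) (topspace M - U') \<union> K (M closure_of W) (M closure_of U')"
    proof (cases "vx g \<in> U'")
      case True
      then show ?thesis using near[OF q(1,4,5) UW(2)] q(1) sub[OF UW'(1)] unfolding K_def by blast
    next
      case False
      then show ?thesis using near[OF q(1,2,3) UW(1)] q(1) vx_in[OF q(1)] unfolding K_def by blast
    qed
  qed
  ultimately show ?thesis by (meson finite_Un finite_subset)
qed

text \<open>The defining condition is closed, so an accumulation point \<open>Q\<close> belongs to
  the set. Any other member \<open>q\<close> is separated from \<open>Q\<close> by some
  \<open>g\<close> and some \<open>(A, B)\<close> in \<open>P\<close>, and only finitely many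
  \<open>g\<close> occur. So finitely many closed sets, the preimages of \<open>A\<close> under
  these \<open>g\<close>, cover all members except \<open>Q\<close>. None contains \<open>Q\<close>,
  which \<open>g\<close> sends into \<open>B\<close>, although \<open>Q\<close> is a limit of the
  others.\<close>

lemma finite_horo_points: "finite horo_points"
proof (rule ccontr)
  assume inf: "infinite horo_points"
  have sub: "horo_points \<subseteq> topspace X" by (auto simp: horo_points_def)
  obtain Q where Q: "Q \<in> X derived_set_of horo_points"
    using compact_space_imp_Bolzano_Weierstrass[OF X(1) inf sub] by blast
  then have QX: "Q \<in> topspace X"
    and D: "\<And>T. openin X T \<Longrightarrow> Q \<in> T \<Longrightarrow> \<exists>y. y \<noteq> Q \<and> y \<in> horo_points \<and> y \<in> T"
    by (auto simp: in_derived_set_of)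
  have "horocyclic Q \<one>" unfolding horocyclic_def
  proof (intro allI impI)
    fix U assume U: "openin M U \<and> Inl Q \<in> U"
    then have "openin X {x \<in> topspace X. Inl x \<in> U}" "Q \<in> {x \<in> topspace X. Inl x \<in> U}"
      using Inl_preimage_open QX by auto
    from D[OF this] obtain q where "q \<in> horo_points" "Inl q \<in> U" by blast
    then show "\<exists>x y. between x \<one> y \<and> vx x \<in> U \<and> vx y \<in> U"
      using U unfolding horo_points_def horocyclic_def by blast
  qed
  then have QN: "Q \<in> horo_points" using QX by (simp add: horo_points_def)
  obtain P where P': "finite P \<and> (\<forall>A B. (A, B) \<in> P \<longrightarrow> closedin X A \<and> closedin X B \<and> disjnt A B) \<and>
    (\<forall>x\<in>topspace X. \<forall>y\<in>topspace X. x \<noteq> y \<longrightarrow>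
       (\<exists>g\<in>carrier G. \<exists>A B. (A, B) \<in> P \<and> \<phi> g x \<in> A \<and> \<phi> g y \<in> B))"
    using two_cocompact_separation[OF actX cocomp X] by (elim exE)
  then have P: "finite P" "\<And>A B. (A, B) \<in> P \<Longrightarrow> closedin X A \<and> closedin X B \<and> disjnt A B"
    "\<And>x y. x \<in> topspace X \<Longrightarrow> y \<in> topspace X \<Longrightarrow> x \<noteq> y \<Longrightarrow>
       \<exists>g\<in>carrier G. \<exists>A B. (A, B) \<in> P \<and> \<phi> g x \<in> A \<and> \<phi> g y \<in> B"
    by simp_all
  define \<Gamma> where "\<Gamma> = (\<lambda>(A, B). {g \<in> carrier G. (\<exists>q\<in>horo_points. \<phi> g q \<in> A) \<and> \<phi> g Q \<in> B})"
  have \<Gamma>: "finite (\<Gamma> c)" if c: "c \<in> P" for c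
  proof -
    obtain A B where AB: "c = (A, B)" by fastforce
    have "closedin M (Inl ` A)" "closedin M (Inl ` B)" "disjnt (Inl ` A) (Inl ` B :: ('x + 'v) set)"
      using P(2)[of A B] c AB Inl_closed by (auto simp: disjnt_iff)
    then have "finite {g \<in> carrier G. (\<exists>q\<in>horo_points. Inl (\<phi> g q) \<in> (Inl ` A :: ('x + 'v) set)) \<and>
        (\<exists>q\<in>horo_points. Inl (\<phi> g q) \<in> (Inl ` B :: ('x + 'v) set))}"
      by (rule finite_horo_pairs)
    then show ?thesis unfolding \<Gamma>_def AB prod.case
      by (rule rev_finite_subset) (use QN in blast)
  qed
  define Z where "Z = (\<Union>c\<in>P. (\<lambda>g. {x \<in> topspace X. \<phi> g x \<in> fst c}) ` \<Gamma> c)"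
  have "closedin X (\<Union>Z)"
  proof (rule closedin_Union)
    show "finite Z" using P(1) \<Gamma> by (simp add: Z_def)
    fix z assume "z \<in> Z"
    then obtain A B g where z: "(A, B) \<in> P" "g \<in> carrier G" "z = {x \<in> topspace X. \<phi> g x \<in> A}"
      by (auto simp: Z_def \<Gamma>_def)
    have "continuous_map X X (\<phi> g)" using actX z(2) unfolding acts_by_homeos_def
      by (blast intro: homeomorphic_imp_continuous_map)
    then show "closedin X z" using P(2)[OF z(1)] z(3) closedin_continuous_map_preimage by blast
  qed
  moreover have "horo_points - {Q} \<subseteq> \<Union>Z"
  proof
    fix q assume q: "q \<in> horo_points - {Q}"
    then have q': "q \<in> topspace X" "q \<noteq> Q" using sub by auto
    obtain g A B where g: "g \<in> carrier G" "(A, B) \<in> P" "\<phi> g q \<in> A" "\<phi> g Q \<in> B"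
      using P(3)[OF q'(1) QX q'(2)] by (elim bexE exE conjE)
    have "g \<in> \<Gamma> (A, B)" using q g unfolding \<Gamma>_def by auto
    then have "{x \<in> topspace X. \<phi> g x \<in> fst (A, B)} \<in> Z"
      unfolding Z_def using g(2) by (intro UN_I[of "(A, B)"] imageI)
    then show "q \<in> \<Union>Z" by (rule UnionI) (use g(3) q'(1) in simp)
  qed
  moreover have "Q \<in> X closure_of (horo_points - {Q})"
    unfolding in_closure_of
  proof (intro conjI allI impI QX)
    fix T assume "Q \<in> T \<and> openin X T"
    then show "\<exists>y. y \<in> horo_points - {Q} \<and> y \<in> T" using D[of T] by auto
  qed
  ultimately have "Q \<in> \<Union>Z" by (meson closure_of_minimal subsetD)
  then obtain A B g where "(A, B) \<in> P" "\<phi> g Q \<in> A" "\<phi> g Q \<in> B"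
    by (auto simp: Z_def \<Gamma>_def)
  then show False using P(2)[of A B] by (auto simp: disjnt_iff)
qed

text \<open>If \<open>inv g\<close> and \<open>inv (c q)\<close> send \<open>p\<close> to the same
  \<open>q\<close>, then \<open>g \<otimes> inv (c q)\<close> fixes \<open>p\<close> and differs
  from \<open>g\<close> by right multiplication with \<open>c q\<close>. One representative for each
  of the finitely many \<open>q\<close> suffices.\<close>

lemma horocyclic_near_stabilizer:
  assumes p: "p \<in> topspace X"
  shows "\<exists>R. \<forall>g\<in>carrier G. horocyclic p g \<longrightarrow> (\<exists>h\<in>stabilizer G \<phi> p. wd h g \<le> R)"
proof -
  define c where "c q = (SOME g. g \<in> carrier G \<and> \<phi> (inv g) p = q)" for q
  \<comment> \<open>The inserted \<open>0\<close> gives \<open>Max\<close> a nonempty set. Points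
    outside the orbit of \<open>p\<close> have arbitrary representatives, which can only enlarge
    \<open>R\<close>.\<close>
  define R where "R = Max (insert 0 ((\<lambda>q. wlen (c q)) ` horo_points))"
  have "\<exists>h\<in>stabilizer G \<phi> p. wd h g \<le> R" if g: "g \<in> carrier G" and h: "horocyclic p g" for g
  proof -
    let ?q = "\<phi> (inv g) p"
    have "horocyclic ?q (inv g \<otimes> g)" using g p h by (intro horocyclic_mult) auto
    then have q: "?q \<in> horo_points" using g p XA.element_image[of "inv g" p] by (auto simp: horo_points_def)
    have "c ?q \<in> carrier G \<and> \<phi> (inv (c ?q)) p = ?q"
      unfolding c_def by (rule someI_ex) (use g in blast)
    then have c: "c ?q \<in> carrier G" "\<phi> (inv (c ?q)) p = ?q" by auto
    let ?h = "g \<otimes> inv (c ?q)"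
    have "\<phi> ?h p = \<phi> g ?q" using c g p XA.composition_rule[of p g "inv (c ?q)"] by simp
    also have "\<dots> = \<phi> (g \<otimes> inv g) p" using g p by (intro XA.composition_rule[symmetric]) auto
    also have "\<dots> = p" using g p XA.id_eq_one by (simp add: fun_eq_iff) (metis restrict_apply')
    finally have "?h \<in> stabilizer G \<phi> p" using c g by (simp add: stabilizer_def)
    moreover have "wd ?h g = wd (?h \<otimes> \<one>) (?h \<otimes> c ?q)" using c g by (simp add: m_assoc)
    then have "wd ?h g = wlen (c ?q)" using c g by (subst (asm) wd_mult) auto
    moreover have "wlen (c ?q) \<le> R" unfolding R_def using q finite_horo_points by (intro Max_ge) auto
    ultimately show ?thesis by (metis order_refl)
  qed
  then show ?thesis by blast
qed

text \<open>All translates \<open>h \<otimes> s\<close> are horocyclic for \<open>p\<close>, so they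
  lie between elements with vertices in a smaller neighbourhood of \<open>p\<close>; by
  \<open>finite_between\<close> only finitely many of their own vertices escape
  \<open>U\<close>.\<close>

lemma stabilizer_vertices_tendsto:
  assumes p: "p \<in> topspace X" and s: "s \<in> carrier G" and hp: "horocyclic p s"
    and U: "openin M U" "Inl p \<in> U"
  shows "finite {h \<in> stabilizer G \<phi> p. vx (h \<otimes> s) \<notin> U}"
proof -
  obtain W where W: "openin M W" "Inl p \<in> W" "M closure_of W \<subseteq> U" using shrink[OF p U] .
  have sub: "W \<subseteq> M closure_of W" by (rule closure_of_subset[OF openin_subset[OF W(1)]])
  let ?B = "{g \<in> carrier G. vx g \<in> topspace M - U \<and>
    (\<exists>x y. between x g y \<and> vx x \<in> M closure_of W \<and> vx y \<in> M closure_of W)}"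
  have "finite ?B" using U(1) W(3) by (intro finite_between) (auto simp: disjnt_iff)
  moreover have "{h \<in> stabilizer G \<phi> p. vx (h \<otimes> s) \<notin> U} \<subseteq> (\<lambda>g. g \<otimes> inv s) ` ?B"
  proof
    fix h assume "h \<in> {h \<in> stabilizer G \<phi> p. vx (h \<otimes> s) \<notin> U}"
    then have h: "h \<in> carrier G" "\<phi> h p = p" "vx (h \<otimes> s) \<notin> U" by (auto simp: stabilizer_def)
    have "horocyclic p (h \<otimes> s)" using horocyclic_mult[OF h(1) p hp] h(2) by simp
    then obtain x y where "between x (h \<otimes> s) y" "vx x \<in> W" "vx y \<in> W"
      using W(1,2) unfolding horocyclic_def by blast
    then have "h \<otimes> s \<in> ?B" using sub h s vx_in[of "h \<otimes> s"] by auto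
    moreover have "h = h \<otimes> s \<otimes> inv s" using h s by (simp add: m_assoc)
    ultimately show "h \<in> (\<lambda>g. g \<otimes> inv s) ` ?B" by (rule rev_image_eqI)
  qed
  ultimately show ?thesis using finite_surj by blast
qed

section \<open>Dynamics of the stabilizer of a point\<close>

lemma stabilizer_inv: "p \<in> topspace X \<Longrightarrow> h \<in> stabilizer G \<phi> p \<Longrightarrow> inv h \<in> stabilizer G \<phi> p"
  using XA.stabilizer_m_inv_closed[of p h] by auto

lemma stabilizer_in: "h \<in> stabilizer G \<phi> p \<Longrightarrow> h \<in> carrier G"
  by (simp add: stabilizer_def)

lemma fixed_point_in_limit_set:
  assumes "p \<in> topspace X" "infinite (stabilizer G \<phi> p)"
  shows "p \<in> limit_set (stabilizer G \<phi> p) X \<phi>"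
proof -
  have "\<not> properly_discontinuous_at (stabilizer G \<phi> p) X \<phi> p"
  proof
    assume "properly_discontinuous_at (stabilizer G \<phi> p) X \<phi> p"
    then obtain U where U: "p \<in> U" "finite {h \<in> stabilizer G \<phi> p. \<phi> h ` U \<inter> U \<noteq> {}}"
      unfolding properly_discontinuous_at_def by blast
    have "stabilizer G \<phi> p \<subseteq> {h \<in> stabilizer G \<phi> p. \<phi> h ` U \<inter> U \<noteq> {}}"
      using U(1) by (force simp: stabilizer_def)
    then show False using U(2) assms(2) finite_subset by blast
  qed
  then show ?thesis using assms(1) by (simp add: limit_set_def)
qed

text \<open>Were \<open>q\<close> another limit point, infinitely many \<open>h\<close> would nearly fix \<open>q\<close> while, with \<open>w\<close> the vertex of
  \<open>s\<close>, both \<open>h w\<close> and \<open>h\<^sup>-\<^sup>1 w\<close> are close to \<open>p\<close>: such \<open>h\<close> move the triple \<open>(q, h\<^sup>-\<^sup>1 w, w)\<close> to a triple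
  close to \<open>(q, w, p)\<close>.\<close>

lemma parabolic_if_horocyclic:
  assumes p: "p \<in> topspace X" and s: "s \<in> carrier G" and hp: "horocyclic p s"
    and inf: "infinite (stabilizer G \<phi> p)"
  shows "parabolic_point G X \<phi> p"
proof -
  let ?H = "stabilizer G \<phi> p"
  have "q \<notin> limit_set ?H X \<phi>" if qp: "q \<noteq> p" for q
  proof
    assume "q \<in> limit_set ?H X \<phi>"
    then have q: "q \<in> topspace X" "\<not> properly_discontinuous_at ?H X \<phi> q" by (auto simp: limit_set_def)
    obtain U W where UW: "openin M U" "openin M W" "Inl p \<in> U" "Inl q \<in> W" "disjnt (M closure_of U) (M closure_of W)"
      using point_separation[OF p q(1)] qp by metis
    let ?w = "vx s"
    \<comment> \<open>Removing the isolated vertex keeps the closures closed and makes them disjoint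
      from it.\<close>
    define C where "C D = M closure_of D - {?w}" for D
    have cl: "closedin M (C D)" for D
      unfolding C_def by (rule closedin_diff[OF closedin_closure_of vx_open[OF s]])
    have sub: "D - {?w} \<subseteq> C D" if "openin M D" for D
      using closure_of_subset[OF openin_subset[OF that]] by (auto simp: C_def)
    have dj: "disjnt (C W) (C U)" "disjnt (C D) {?w}" "disjnt {?w} (C D)" for D
      using UW(5) by (auto simp: C_def disjnt_iff)
    define T where "T = {g \<in> carrier G. act g ` C W \<inter> C W \<noteq> {} \<and> act g ` C U \<inter> {?w} \<noteq> {} \<and> act g ` {?w} \<inter> C U \<noteq> {}}"
    have T: "finite T"
      unfolding T_def by (rule three_discontinuous_finite[OF tdM M(1)]) (use cl dj vx_closed[OF s] in auto)
    let ?U = "U - {?w}"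
    have U': "openin M ?U" "Inl p \<in> ?U" using UW(1,3) vx_closed[OF s] by (auto intro: openin_diff)
    let ?B1 = "{h \<in> ?H. vx (h \<otimes> s) \<notin> ?U}" and ?B2 = "{h \<in> ?H. vx (inv h \<otimes> s) \<notin> ?U}"
    have B1: "finite ?B1" by (rule stabilizer_vertices_tendsto[OF p s hp U'])
    have "?B2 \<subseteq> (\<lambda>h. inv h) ` ?B1"
    proof
      fix h assume h: "h \<in> ?B2"
      then have "inv h \<in> ?B1" "h = inv (inv h)" using stabilizer_inv[OF p] stabilizer_in by auto
      then show "h \<in> (\<lambda>h. inv h) ` ?B1" by (rule rev_image_eqI)
    qed
    then have B2: "finite ?B2" using B1 finite_surj by blast
    let ?O = "{x \<in> topspace X. Inl x \<in> W}"
    have "{h \<in> ?H. \<phi> h ` ?O \<inter> ?O \<noteq> {}} \<subseteq> T \<union> ?B1 \<union> ?B2"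
    proof
      fix h assume h: "h \<in> {h \<in> ?H. \<phi> h ` ?O \<inter> ?O \<noteq> {}}"
      then have hG: "h \<in> carrier G" by (simp add: stabilizer_def)
      obtain x where x: "x \<in> ?O" "\<phi> h x \<in> ?O" using h by blast
      have "h \<in> T" if "h \<notin> ?B1" "h \<notin> ?B2"
      proof -
        have "Inl x \<in> C W" "act h (Inl x) \<in> C W" using x sub[OF UW(2)] act_Inl[of x h] by auto
        then have "act h ` C W \<inter> C W \<noteq> {}" by blast
        moreover have "vx (inv h \<otimes> s) \<in> C U" "act h (vx (inv h \<otimes> s)) = ?w"
          using that h hG s sub[OF UW(1)] by (auto simp: act_vx m_assoc[symmetric])
        then have "act h ` C U \<inter> {?w} \<noteq> {}" by blast
        moreover have "act h ?w \<in> C U" using that h hG s sub[OF UW(1)] by (auto simp: act_vx)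
        then have "act h ` {?w} \<inter> C U \<noteq> {}" by blast
        ultimately show ?thesis using hG by (simp add: T_def)
      qed
      then show "h \<in> T \<union> ?B1 \<union> ?B2" by blast
    qed
    then have "finite {h \<in> ?H. \<phi> h ` ?O \<inter> ?O \<noteq> {}}" using T B1 B2 by (meson finite_Un finite_subset)
    moreover have "openin X ?O" "q \<in> ?O" using Inl_preimage_open[OF UW(2)] q(1) UW(4) by auto
    ultimately show False using q(2) unfolding properly_discontinuous_at_def by blast
  qed
  then have "limit_set ?H X \<phi> = {p}" using fixed_point_in_limit_set[OF p inf] by blast
  then show ?thesis using p by (simp add: parabolic_point_def)
qed

text \<open>Here \<open>v\<close> denotes the vertex of the identity. Since \<open>h v\<close> tends to \<open>x\<close> and \<open>h p = p\<close>, the point \<open>h x\<close> must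
  approach \<open>p\<close> if it stays away from \<open>x\<close>; but then \<open>h\<^sup>-\<^sup>1 v\<close>, which differs from \<open>v\<close> and is far from
  \<open>p\<close> or from \<open>x\<close>, completes a triple that is moved to a triple close to \<open>(x, p, v)\<close>.\<close>

lemma fixing_sequence_accumulates:
  assumes I: "I \<subseteq> carrier G" "infinite I" and p: "p \<in> topspace X" and x: "x \<in> topspace X" "x \<noteq> p"
    and fix': "\<And>h. h \<in> I \<Longrightarrow> \<phi> h p = p"
    and conv: "\<And>U. openin M U \<Longrightarrow> Inl x \<in> U \<Longrightarrow> finite {h \<in> I. vx h \<notin> U}"
    and N: "openin X N" "x \<in> N"
  shows "infinite {h \<in> I. \<phi> h x \<in> N}"
proof
  assume fin: "finite {h \<in> I. \<phi> h x \<in> N}"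
  let ?v = "vx \<one>"
  obtain U W where UW: "openin M U" "openin M W" "Inl p \<in> U" "Inl x \<in> W" "disjnt (M closure_of U) (M closure_of W)"
    using point_separation[OF p x(1)] x(2) by metis
  define Op where "Op = U - {?v}"
  \<comment> \<open>Points of \<open>X\<close> outside \<open>N\<close> are removed, so that
    \<open>h x\<close> outside \<open>N\<close> forces its copy in \<open>M\<close> to lie outside
    \<open>Ox\<close>.\<close>
  define Ox where "Ox = W - {?v} - Inl ` (topspace X - N)"
  have vcl: "closedin M {?v}" by (rule vx_closed) simp
  have vop: "openin M {?v}" by (rule vx_open) simp
  have Op: "openin M Op" "Inl p \<in> Op" unfolding Op_def using UW vcl by (auto intro: openin_diff)
  have "closedin M (Inl ` (topspace X - N))" using N(1) by (intro Inl_closed) blast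
  then have Ox: "openin M Ox" "Inl x \<in> Ox" unfolding Ox_def using UW vcl N by (auto intro!: openin_diff)
  obtain O' where O': "openin M O'" "Inl x \<in> O'" "M closure_of O' \<subseteq> Ox" using shrink[OF x(1) Ox] .
  define Cp where "Cp = M closure_of U - {?v}"
  let ?Cx = "M closure_of O'"
  have subU: "U \<subseteq> M closure_of U" by (rule closure_of_subset[OF openin_subset[OF UW(1)]])
  have subW: "W \<subseteq> M closure_of W" by (rule closure_of_subset[OF openin_subset[OF UW(2)]])
  have subO: "O' \<subseteq> ?Cx" by (rule closure_of_subset[OF openin_subset[OF O'(1)]])
  have cls: "closedin M ?Cx" "closedin M Cp" "closedin M {Inl p}" "closedin M {Inl x}" "closedin M {?v}"
    unfolding Cp_def using vcl vop closedin_Hausdorff_singleton[OF M(2) Inl_in] p x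
    by (auto intro!: closedin_diff)
  \<comment> \<open>\<open>T1\<close> serves the case that \<open>h x\<close> is away from both
    \<open>x\<close> and \<open>p\<close>. If \<open>h x\<close> is close to \<open>p\<close>, then
    \<open>T2\<close> or \<open>T3\<close> applies, according as the vertex of \<open>inv h\<close>
    is outside \<open>Op\<close> or outside \<open>Ox\<close>.\<close>
  define T1 where "T1 = {g \<in> carrier G. act g ` {?v} \<inter> ?Cx \<noteq> {} \<and> act g ` {Inl p} \<inter> {Inl p} \<noteq> {} \<and>
    act g ` {Inl x} \<inter> (topspace M - Ox - Op) \<noteq> {}}"
  define T2 where "T2 = {g \<in> carrier G. act g ` {?v} \<inter> ?Cx \<noteq> {} \<and> act g ` {Inl p} \<inter> {Inl p} \<noteq> {} \<and>
    act g ` (topspace M - {?v} - Op) \<inter> {?v} \<noteq> {}}"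
  define T3 where "T3 = {g \<in> carrier G. act g ` {?v} \<inter> ?Cx \<noteq> {} \<and> act g ` {Inl x} \<inter> Cp \<noteq> {} \<and>
    act g ` (topspace M - {?v} - Ox) \<inter> {?v} \<noteq> {}}"
  have dpx: "Inl p \<notin> W" "Inl p \<notin> ?Cx" "disjnt ?Cx Cp" "?v \<notin> ?Cx" "disjnt Op Ox"
    using UW(3,5) subU subW O'(3) by (auto simp: disjnt_iff Ox_def Cp_def Op_def)
  have clO: "closedin M (topspace M - Ox - Op)" "closedin M (topspace M - {?v} - Op)" "closedin M (topspace M - {?v} - Ox)"
    using Op(1) Ox(1) vop by (auto intro!: closedin_diff)
  have "finite T1" unfolding T1_def
    by (rule three_discontinuous_finite[OF tdM M(1)])
       (use cls clO dpx O'(3) Op(2) x(2) in \<open>auto simp: disjnt_iff\<close>)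
  moreover have "finite T2" unfolding T2_def
    by (rule three_discontinuous_finite[OF tdM M(1)])
       (use cls clO dpx O'(3) Op(2) in \<open>auto simp: disjnt_iff\<close>)
  moreover have "finite T3" unfolding T3_def
    by (rule three_discontinuous_finite[OF tdM M(1)])
       (use cls clO dpx O'(3) Ox(2) in \<open>auto simp: disjnt_iff Cp_def\<close>)
  moreover have "finite {h \<in> I. vx h \<notin> O'}" by (rule conv[OF O'(1,2)])
  moreover have "I \<subseteq> {h \<in> I. \<phi> h x \<in> N} \<union> {h \<in> I. vx h \<notin> O'} \<union> T1 \<union> T2 \<union> T3"
  proof
    fix h assume h: "h \<in> I"
    then have hG: "h \<in> carrier G" using I by auto
    have "h \<in> T1 \<union> T2 \<union> T3" if hN: "\<phi> h x \<notin> N" and hO: "vx h \<in> O'"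
    proof -
      have av: "act h ?v \<in> ?Cx" using hO hG subO by (auto simp: act_vx)
      have ap: "act h (Inl p) = Inl p" using fix'[OF h] act_Inl[OF p] by simp
      have hx: "\<phi> h x \<in> topspace X" using XA.element_image[OF hG x(1)] by simp
      have ax: "act h (Inl x) \<in> topspace M - Ox"
        using hx hN act_Inl[OF x(1)] Inl_in[OF hx] by (auto simp: Ox_def)
      let ?y = "vx (inv h)"
      have ay: "act h ?y = ?v" using hG by (simp add: act_vx)
      have "?y \<noteq> ?v"
      proof
        assume "?y = ?v"
        then have "act h ?v = ?v" using ay by simp
        then show False using av dpx(4) by simp
      qed
      moreover have "?y \<in> topspace M" using hG by (intro vx_in) auto
      moreover have "?y \<notin> Op \<or> ?y \<notin> Ox" using dpx(5) by (auto simp: disjnt_iff)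
      ultimately have yy: "?y \<in> topspace M - {?v} - Op \<or> ?y \<in> topspace M - {?v} - Ox" by blast
      show ?thesis
      proof (cases "act h (Inl x) \<in> Op")
        case False
        then have "h \<in> T1" unfolding T1_def using av ap ax hG by blast
        then show ?thesis by blast
      next
        case True
        then have aC: "act h (Inl x) \<in> Cp" using subU by (auto simp: Op_def Cp_def)
        show ?thesis using yy
        proof
          assume "?y \<in> topspace M - {?v} - Op"
          then have "h \<in> T2" unfolding T2_def using av ap ay hG by blast
          then show ?thesis by blast
        next
          assume "?y \<in> topspace M - {?v} - Ox"
          then have "h \<in> T3" unfolding T3_def using av aC ay hG by blast
          then show ?thesis by blast
        qed
      qed
    qed
    then show "h \<in> {h \<in> I. \<phi> h x \<in> N} \<union> {h \<in> I. vx h \<notin> O'} \<union> T1 \<union> T2 \<union> T3" using h by blast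
  qed
  ultimately show False using fin I(2) by (meson finite_Un finite_subset)
qed

end

section \<open>Fibres of the Floyd map\<close>

text \<open>Indices chosen one at a time satisfy \<open>m \<le> n m\<close> without being
  increasing, and this already preserves the limit.\<close>

lemma limitin_subsequence:
  assumes "limitin X s a sequentially" "\<And>m. m \<le> n m"
  shows "limitin X (\<lambda>m. s (n m)) a sequentially"
  using assms unfolding limitin_sequentially by (meson le_trans)

lemma infinite_pigeonhole:
  assumes "infinite I" "finite K" "\<And>n. n \<in> I \<Longrightarrow> u n \<in> K"
  shows "\<exists>z\<in>K. infinite {n \<in> I. u n = z}"
proof -
  have "finite (u ` I)" using assms(2,3) by (meson finite_subset image_subsetI)
  then obtain n0 where "n0 \<in> I" "infinite {n \<in> I. u n = u n0}" using pigeonhole_infinite[OF assms(1)] by blast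
  then show ?thesis using assms(3) by blast
qed

text \<open>\<open>\<Phi>\<close> stands for the composite of \<open>\<Psi>\<close> with the
  extension of the identity; through it the comparison of \<open>f\<close> with the exponential
  function enters.\<close>

locale floyd_boundary_map = floyd_graph_action +
  fixes f :: "nat \<Rightarrow> real" and \<Phi> :: "(nat \<Rightarrow> 'a) set \<Rightarrow> 'c + 'd" and F :: "(nat \<Rightarrow> 'a) set \<Rightarrow> 'c"
  assumes f: "floyd_function f"
    and cont: "continuous_map (floyd_completion G S f) M \<Phi>"
    and embed: "\<And>g. g \<in> carrier G \<Longrightarrow> \<Phi> (floyd_embed G S f g) = vx g"
    and bdry: "\<And>a. a \<in> floyd_boundary G S f \<Longrightarrow> F a \<in> topspace X \<and> \<Phi> a = Inl (F a)"
begin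

sublocale D: Metric_space "carrier G" "fd f" by (rule Metric_space_fd[OF f])

abbreviation "FC \<equiv> floyd_completion G S f"
abbreviation "em \<equiv> floyd_embed G S f"
abbreviation "bd \<equiv> floyd_boundary G S f"
abbreviation "CC \<equiv> cauchy_completion (carrier G) (fd f)"

lemma embed_in: "g \<in> carrier G \<Longrightarrow> em g \<in> CC"
  unfolding floyd_embed_def by (rule D.completion_embed_in)

lemma topspace_FC: "topspace FC = CC"
  by (simp add: floyd_completion_def D.topspace_completion)

lemma boundary_iff: "a \<in> bd \<longleftrightarrow> a \<in> CC \<and> a \<notin> em ` carrier G"
  by (simp add: floyd_boundary_def topspace_FC)

lemma em_open: 
  assumes g: "g \<in> carrier G" shows "openin FC {em g}"
  unfolding floyd_completion_def floyd_embed_def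
proof (rule D.completion_isolated[OF g])
  show "0 < f (max 1 (wlen g))" by (rule floyd_function_pos[OF f]) simp
  show "f (max 1 (wlen g)) \<le> fd f g y" if "y \<in> carrier G" "y \<noteq> g" for y
    using fd_isolated[OF f g that(1)] that(2) by simp
qed

lemma limit_vertices:
  assumes lim: "limitin FC (\<lambda>n. em (s n)) a sequentially" and s: "\<And>n. s n \<in> carrier G" and a: "a \<in> bd"
    and U: "openin M U" "Inl (F a) \<in> U"
  shows "\<forall>\<^sub>F n in sequentially. vx (s n) \<in> U"
proof -
  have "limitin M (\<lambda>n. vx (s n)) (Inl (F a)) sequentially"
    using continuous_map_limit[OF cont lim] embed[OF s] bdry[OF a] by (simp add: o_def)
  then show ?thesis using U by (simp add: limitin_def)
qed

text \<open>Elements of \<open>G\<close> are isolated in the completion. A closure point that is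
  such an element therefore belongs to the image of \<open>H\<close> and is interior, and what is
  left of the closure lies in the boundary.\<close>

lemma frontier_iff:
  assumes H: "H \<subseteq> carrier G"
  shows "a \<in> FC frontier_of (em ` H) \<longleftrightarrow> a \<in> bd \<and> (\<exists>s. range s \<subseteq> H \<and> limitin FC (\<lambda>n. em (s n)) a sequentially)"
proof -
  interpret C: Metric_space CC "completion_dist (carrier G) (fd f)" by (rule D.Metric_space_completion)
  have FC: "FC = C.mtopology" by (simp add: floyd_completion_def completion_topology_def)
  have sub: "em ` H \<subseteq> CC" using H embed_in by auto
  have cl: "a \<in> FC closure_of (em ` H) \<longleftrightarrow> (\<exists>s. range s \<subseteq> H \<and> limitin FC (\<lambda>n. em (s n)) a sequentially)"
  proof
    assume "a \<in> FC closure_of (em ` H)"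
    then obtain \<sigma> where \<sigma>: "range \<sigma> \<subseteq> em ` H" "limitin FC \<sigma> a sequentially"
      unfolding FC C.closure_of_sequentially by auto
    then have "\<forall>n. \<exists>h. h \<in> H \<and> \<sigma> n = em h" by blast
    then obtain s where "\<forall>n. s n \<in> H \<and> \<sigma> n = em (s n)" by metis
    then show "\<exists>s. range s \<subseteq> H \<and> limitin FC (\<lambda>n. em (s n)) a sequentially"
      using \<sigma>(2) by (intro exI[of _ s]) (auto simp: limitin_def)
  next
    assume "\<exists>s. range s \<subseteq> H \<and> limitin FC (\<lambda>n. em (s n)) a sequentially"
    then obtain s where s: "range s \<subseteq> H" "limitin FC (\<lambda>n. em (s n)) a sequentially" by blast
    have "a \<in> CC" using limitin_topspace[OF s(2)] topspace_FC by simp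
    moreover have "range (\<lambda>n. em (s n)) \<subseteq> em ` H \<inter> CC" using s(1) sub by blast
    ultimately show "a \<in> FC closure_of (em ` H)"
      using s(2) unfolding FC C.closure_of_sequentially by blast
  qed
  have int: "a \<in> FC interior_of (em ` H)" if acl: "a \<in> FC closure_of (em ` H)" and "a \<notin> bd"
  proof -
    have "a \<in> CC" using acl by (simp add: in_closure_of topspace_FC)
    then obtain g where g: "g \<in> carrier G" "a = em g" using \<open>a \<notin> bd\<close> by (auto simp: boundary_iff)
    have "\<And>T. openin FC T \<Longrightarrow> a \<in> T \<Longrightarrow> \<exists>y. y \<in> em ` H \<and> y \<in> T" using acl by (simp add: in_closure_of)
    from this[OF em_open[OF g(1)]] have "\<exists>y. y \<in> em ` H \<and> y \<in> {em g}" using g(2) by simp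
    then have "{em g} \<subseteq> em ` H" by blast
    then have "{em g} \<subseteq> FC interior_of (em ` H)" using em_open[OF g(1)] by (rule interior_of_maximal)
    then show ?thesis using g by blast
  qed
  have "a \<notin> FC interior_of (em ` H)" if "a \<in> bd"
    using that H interior_of_subset[of FC "em ` H"] by (auto simp: boundary_iff)
  then show ?thesis unfolding frontier_of_def using cl int by blast
qed

text \<open>If stabilizer elements converge to \<open>a\<close>, their vertices tend to
  \<open>F a\<close>. Were this not \<open>p\<close>, infinitely many of them would bring
  \<open>F a\<close> back into any of its neighbourhoods, although \<open>F a\<close> lies outside
  the one-point limit set.\<close>

lemma frontier_fibre:
  assumes par: "parabolic_point G X \<phi> p" and a: "a \<in> FC frontier_of (em ` stabilizer G \<phi> p)"
  shows "F a = p"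
proof (rule ccontr)
  assume ne: "F a \<noteq> p"
  let ?H = "stabilizer G \<phi> p"
  have HG: "?H \<subseteq> carrier G" by (auto simp: stabilizer_def)
  obtain s where s: "range s \<subseteq> ?H" "limitin FC (\<lambda>n. em (s n)) a sequentially" and aB: "a \<in> bd"
    using a unfolding frontier_iff[OF HG] by blast
  have sG: "s n \<in> carrier G" for n using s(1) HG by blast
  have p: "p \<in> topspace X" and card: "card (limit_set ?H X \<phi>) = 1" using par by (auto simp: parabolic_point_def)
  have inf: "infinite (range s)"
    using D.completion_limit_infinite_range[of s a] s(2) sG aB
    by (simp add: boundary_iff floyd_completion_def floyd_embed_def)
  then have "infinite ?H" using s(1) finite_subset by blast
  then have "p \<in> limit_set ?H X \<phi>" by (rule fixed_point_in_limit_set[OF p])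
  then have "F a \<notin> limit_set ?H X \<phi>" using card ne by (auto simp: card_1_singleton_iff)
  then have "properly_discontinuous_at ?H X \<phi> (F a)" using bdry[OF aB] by (simp add: limit_set_def)
  then obtain N where N: "openin X N" "F a \<in> N" "finite {h \<in> ?H. \<phi> h ` N \<inter> N \<noteq> {}}"
    unfolding properly_discontinuous_at_def by blast
  have conv: "finite {h \<in> range s. vx h \<notin> U}" if U: "openin M U" "Inl (F a) \<in> U" for U
  proof -
    obtain n0 where "\<forall>n\<ge>n0. vx (s n) \<in> U"
      using limit_vertices[OF s(2) sG aB U] by (auto simp: eventually_sequentially)
    then have "{h \<in> range s. vx h \<notin> U} \<subseteq> s ` {..<n0}"
      by (auto intro!: imageI) (meson linorder_not_le)
    then show ?thesis by (rule finite_subset) simp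
  qed
  have "infinite {h \<in> range s. \<phi> h (F a) \<in> N}"
  proof (rule fixing_sequence_accumulates[OF _ inf p _ ne _ conv N(1,2)])
    show "range s \<subseteq> carrier G" using sG by auto
    show "F a \<in> topspace X" using bdry[OF aB] by simp
    show "\<phi> h p = p" if "h \<in> range s" for h using that s(1) by (auto simp: stabilizer_def)
  qed
  moreover have "{h \<in> range s. \<phi> h (F a) \<in> N} \<subseteq> {h \<in> ?H. \<phi> h ` N \<inter> N \<noteq> {}}"
  proof (intro subsetI CollectI)
    fix h assume "h \<in> {h \<in> range s. \<phi> h (F a) \<in> N}"
    then have "h \<in> ?H" "\<phi> h (F a) \<in> N" using s(1) by auto
    then show "h \<in> ?H \<and> \<phi> h ` N \<inter> N \<noteq> {}" using N(2) by blast
  qed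
  ultimately show False using N(3) finite_subset by blast
qed

section \<open>Two boundary points with the same image\<close>

lemma tail_null:
  assumes "\<And>m. c \<le> m \<Longrightarrow> 0 \<le> x m \<and> x m \<le> floyd_tail f (D m)" "\<And>m. m \<le> D m + c"
  shows "x \<longlonglongrightarrow> 0"
proof (rule LIMSEQ_I)
  fix e :: real assume "e > 0"
  then obtain R where R: "\<And>d. R \<le> d \<Longrightarrow> floyd_tail f d < e" using floyd_tail_small[OF f] by blast
  have "norm (x m - 0) < e" if "R + c \<le> m" for m
    using assms(1)[of m] assms(2)[of m] R[of "D m"] that by fastforce
  then show "\<exists>m0. \<forall>m\<ge>m0. norm (x m - 0) < e" by blast
qed

text \<open>Distinct limits keep \<open>g n\<close> and \<open>k n\<close> Floyd-apart, so
  Karlsson's lemma and the pigeonhole principle fix one \<open>s\<close> between them for infinitely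
  many \<open>n\<close>. Elements farther along towards \<open>g n\<close> are horocyclic for the
  same reason, hence near the stabilizer, and this transfers the limit \<open>a\<close> to
  stabilizer elements.\<close>

lemma collapsed_pair:
  assumes a: "a \<in> bd" and b: "b \<in> bd" and ab: "a \<noteq> b" and Fa: "F a = p" and Fb: "F b = p"
  shows "\<exists>s\<in>carrier G. horocyclic p s" "a \<in> FC frontier_of (em ` stabilizer G \<phi> p)"
proof -
  interpret C: Metric_space CC "completion_dist (carrier G) (fd f)" by (rule D.Metric_space_completion)
  have p: "p \<in> topspace X" using bdry[OF a] Fa by simp
  have aC: "a \<in> CC" and bC: "b \<in> CC" using a b by (auto simp: boundary_iff)
  obtain g where g: "D.MCauchy g" "a = cauchy_equiv (carrier G) (fd f) `` {g}"
    using D.completion_obtain_seq[OF aC] .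
  obtain k where k: "D.MCauchy k" "b = cauchy_equiv (carrier G) (fd f) `` {k}"
    using D.completion_obtain_seq[OF bC] .
  have gG: "g n \<in> carrier G" and kG: "k n \<in> carrier G" for n using g(1) k(1) by (auto simp: D.MCauchy_def)
  have lg: "limitin FC (\<lambda>n. em (g n)) a sequentially" and lk: "limitin FC (\<lambda>n. em (k n)) b sequentially"
    using D.Cauchy_limit_class[OF g(1)] D.Cauchy_limit_class[OF k(1)] g(2) k(2)
    by (simp_all add: floyd_completion_def floyd_embed_def)
  let ?e = "completion_dist (carrier G) (fd f) a b"
  have e: "?e > 0" using ab aC bC by simp
  have "g \<in> a" "k \<in> b" using g k equiv_class_self[OF D.equiv_cauchy_equiv] by auto
  then have "(\<lambda>n. fd f (g n) (k n)) \<longlonglongrightarrow> ?e" using D.completion_dist_tendsto[OF aC bC] by blast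
  then have "\<forall>\<^sub>F n in sequentially. ?e / 2 < fd f (g n) (k n)" by (rule order_tendstoD(1)) (use e in simp)
  then obtain n0 where "\<forall>n\<ge>n0. ?e / 2 < fd f (g n) (k n)" unfolding eventually_sequentially by blast
  then have n0: "?e / 2 \<le> fd f (g n) (k n)" if "n \<ge> n0" for n using that by (blast intro: less_imp_le)
  have e2: "0 < ?e / 2" using e by simp
  obtain R where R: "\<And>x y. x \<in> carrier G \<Longrightarrow> y \<in> carrier G \<Longrightarrow> ?e / 2 \<le> fd f x y \<Longrightarrow> \<exists>u. between x u y \<and> wlen u \<le> R"
    using karlsson[OF f e2] by blast
  then have "\<exists>u. between (g n) u (k n) \<and> wlen u \<le> R" if "n \<in> {n0..}" for n using n0[of n] gG kG that by simp
  then obtain u where u: "\<And>n. n \<in> {n0..} \<Longrightarrow> between (g n) (u n) (k n) \<and> wlen (u n) \<le> R" by metis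
  have "u n \<in> {x \<in> carrier G. wlen x \<le> R}" if "n \<in> {n0..}" for n using u[OF that] by (auto simp: between_def)
  then obtain s where s: "s \<in> carrier G" "infinite {n \<in> {n0..}. u n = s}"
    using infinite_pigeonhole[OF infinite_Ici finite_wball] by blast
  define I0 where "I0 = {n. between (g n) s (k n)}"
  have I0: "infinite I0" 
    by (rule infinite_super[OF _ s(2)]) (use u in \<open>auto simp: I0_def\<close>)
  have horo: "horocyclic p z" if z: "infinite {n. between (g n) z (k n)}" for z
    unfolding horocyclic_def
  proof (intro allI impI)
    fix U assume U: "openin M U \<and> Inl p \<in> U"
    have "\<forall>\<^sub>F n in sequentially. vx (g n) \<in> U \<and> vx (k n) \<in> U"
      using limit_vertices[OF lg gG a] limit_vertices[OF lk kG b] U Fa Fb by (simp add: eventually_conj)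
    then obtain n1 where n1: "\<And>n. n \<ge> n1 \<Longrightarrow> vx (g n) \<in> U \<and> vx (k n) \<in> U" by (auto simp: eventually_sequentially)
    obtain n where "n \<ge> n1" "between (g n) z (k n)" using z by (auto simp: infinite_nat_iff_unbounded_le)
    then show "\<exists>x y. between x z y \<and> vx x \<in> U \<and> vx y \<in> U" using n1 by blast
  qed
  have "infinite {n. between (g n) s (k n)}" using I0 unfolding I0_def .
  then show "\<exists>s\<in>carrier G. horocyclic p s" using horo s(1) by blast
  \<comment> \<open>For fixed \<open>m\<close> the candidates at distance \<open>m\<close> from
    \<open>s\<close> lie in a finite ball, so one of them is between \<open>g n\<close> and
    \<open>k n\<close> for infinitely many \<open>n\<close> and is thus horocyclic. The demand
    \<open>m \<le> n\<close> keeps the chosen \<open>g n\<close> converging to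
    \<open>a\<close>.\<close>
  have "\<exists>z n. m \<le> n \<and> z \<in> carrier G \<and> horocyclic p z \<and> wd s z = m \<and> between s z (g n)" for m
  proof -
    have "\<forall>\<^sub>F n in sequentially. g n \<notin> {x \<in> carrier G. wlen x \<le> m + wlen s}"
      by (rule D.completion_limit_leaves_finite[OF lg[unfolded floyd_completion_def floyd_embed_def] gG _ finite_wball])
         (use a in \<open>simp add: boundary_iff floyd_embed_def\<close>)
    then obtain n1 where n1: "\<And>n. n \<ge> n1 \<Longrightarrow> m + wlen s < wlen (g n)"
      using gG by (auto simp: eventually_sequentially linorder_not_le)
    define I1 where "I1 = {n \<in> I0. max m n1 \<le> n}"
    have I1: "infinite I1" using I0 unfolding I1_def infinite_nat_iff_unbounded_le
      by (simp add: mem_Collect_eq) (metis max.boundedE max.cobounded1 max.cobounded2 le_trans)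
    have "\<exists>z. between s z (g n) \<and> wd s z = m" if "n \<in> I1" for n
      using n1[of n] that dist_triangle[of \<one> s "g n"] s(1) gG by (intro between_exists) (auto simp: I1_def)
    then obtain z where z: "\<And>n. n \<in> I1 \<Longrightarrow> between s (z n) (g n) \<and> wd s (z n) = m" by metis
    have "z n \<in> {x \<in> carrier G. wlen x \<le> wlen s + m}" if "n \<in> I1" for n
      using z[OF that] dist_triangle[of \<one> s "z n"] s(1) by (auto simp: between_def)
    then obtain y where y: "y \<in> carrier G" "infinite {n \<in> I1. z n = y}"
      using infinite_pigeonhole[OF I1 finite_wball] by blast
    have "{n \<in> I1. z n = y} \<subseteq> {n. between (g n) y (k n)}"
    proof
      fix n assume n: "n \<in> {n \<in> I1. z n = y}"
      then have "between (k n) s (g n)" "between s y (g n)" using z[of n] between_sym by (auto simp: I1_def I0_def)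
      then show "n \<in> {n. between (g n) y (k n)}" using between_trans between_sym by blast
    qed
    then have "horocyclic p y" using y(2) by (intro horo) (metis finite_subset)
    moreover have "{n \<in> I1. z n = y} \<noteq> {}" using y(2) by (metis finite.emptyI)
    then obtain n where n: "n \<in> I1" "z n = y" by blast
    have "m \<le> n" using n(1) by (simp add: I1_def)
    ultimately show ?thesis using y(1) z[OF n(1)] n(2) by blast
  qed
  then obtain z n where "\<forall>m. m \<le> n m \<and> z m \<in> carrier G \<and> horocyclic p (z m) \<and> wd s (z m) = m \<and>
      between s (z m) (g (n m))"
    by metis
  then have zn: "\<And>m. m \<le> n m" "\<And>m. z m \<in> carrier G" "\<And>m. horocyclic p (z m)"
      "\<And>m. wd s (z m) = m" "\<And>m. between s (z m) (g (n m))"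
    by simp_all
  have wz: "m \<le> wlen (z m) + wlen s" for m
    using dist_triangle[of s \<one> "z m"] s(1) zn(2)[of m] zn(4)[of m] graph_dist_commute[of _ s \<one>] by simp
  have "(\<lambda>m. fd f (g (n m)) (z m)) \<longlonglongrightarrow> 0"
  proof (rule tail_null[of "wlen s" _ "\<lambda>m. m - wlen s"])
    show "0 \<le> fd f (g (n m)) (z m) \<and> fd f (g (n m)) (z m) \<le> floyd_tail f (m - wlen s)" if "wlen s \<le> m" for m
      using fd_ray[OF f zn(5)[of m]] zn(4)[of m] that D.commute[of "g (n m)" "z m"] by simp
  qed simp
  then have lz: "limitin FC (\<lambda>m. em (z m)) a sequentially"
    using D.completion_limit_shift[of "\<lambda>m. g (n m)" a z] limitin_subsequence[OF lg zn(1)] gG zn(2)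
    by (simp add: floyd_completion_def floyd_embed_def)
  obtain R' where R': "\<And>x. x \<in> carrier G \<Longrightarrow> horocyclic p x \<Longrightarrow> \<exists>h\<in>stabilizer G \<phi> p. wd h x \<le> R'"
    using horocyclic_near_stabilizer[OF p] by blast
  have "\<forall>m. \<exists>h. h \<in> stabilizer G \<phi> p \<and> wd h (z m) \<le> R'" using R'[OF zn(2) zn(3)] by blast
  then obtain h where h: "\<And>m. h m \<in> stabilizer G \<phi> p" "\<And>m. wd (h m) (z m) \<le> R'" by metis
  have hG: "h m \<in> carrier G" for m using h(1) stabilizer_in by blast
  \<comment> \<open>From \<open>m \<ge> wlen s + 2 * R'\<close> on, \<open>z m\<close> has word
    length at least \<open>2 * R'\<close>, as \<open>fd_near\<close> requires.\<close>
  have "(\<lambda>m. fd f (z m) (h m)) \<longlonglongrightarrow> 0"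
  proof (rule tail_null[of "wlen s + 2 * R'" _ "\<lambda>m. wlen (z m)"])
    show "0 \<le> fd f (z m) (h m) \<and> fd f (z m) (h m) \<le> floyd_tail f (wlen (z m))" if "wlen s + 2 * R' \<le> m" for m
      using fd_near[OF f zn(2) hG, of m m R'] h(2)[of m] graph_dist_commute[of _ "h m" "z m"] wz[of m] that by simp
    show "m \<le> wlen (z m) + (wlen s + 2 * R')" for m using wz[of m] by simp
  qed
  then have "limitin FC (\<lambda>m. em (h m)) a sequentially"
    using D.completion_limit_shift[of z a h] lz zn(2) hG
    by (simp add: floyd_completion_def floyd_embed_def)
  then show "a \<in> FC frontier_of (em ` stabilizer G \<phi> p)"
    using a h(1) frontier_iff[of "stabilizer G \<phi> p"] stabilizer_in by blast
qed

lemma frontier_infinite: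
  assumes "a \<in> FC frontier_of (em ` H)" "H \<subseteq> carrier G"
  shows "infinite H"
proof -
  obtain s where s: "range s \<subseteq> H" "limitin FC (\<lambda>n. em (s n)) a sequentially" "a \<in> bd"
    using assms(1) unfolding frontier_iff[OF assms(2)] by blast
  have "infinite (range s)"
    using D.completion_limit_infinite_range[of s a] s assms(2)
    by (auto simp: boundary_iff floyd_completion_def floyd_embed_def)
  then show ?thesis using s(1) finite_subset by blast
qed

text \<open>Total boundedness gives an injective Cauchy sequence in \<open>H\<close>. Its limit is
  no element of \<open>G\<close>, since convergence to an isolated point would make the sequence
  eventually constant.\<close>

lemma infinite_frontier:
  assumes H: "infinite H" "H \<subseteq> carrier G"
  shows "\<exists>b. b \<in> FC frontier_of (em ` H)"
proof -
  obtain h :: "nat \<Rightarrow> 'a" where h: "inj h" "range h \<subseteq> H" using infinite_countable_subset[OF H(1)] by blast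
  then have "range h \<subseteq> carrier G" using H(2) by blast
  then obtain r where r: "strict_mono r" "D.MCauchy (h \<circ> r)"
    using fd_totally_bounded[OF f] unfolding D.mtotally_bounded_sequentially by blast
  let ?b = "cauchy_equiv (carrier G) (fd f) `` {h \<circ> r}"
  have lim: "limitin FC (\<lambda>n. em ((h \<circ> r) n)) ?b sequentially"
    using D.Cauchy_limit_class[OF r(2)] by (simp add: floyd_completion_def floyd_embed_def)
  have hG: "(h \<circ> r) n \<in> carrier G" for n using h(2) H(2) by auto
  have inj: "inj (h \<circ> r)" using h(1) strict_mono_imp_inj_on[OF r(1)] by (rule inj_compose)
  have "?b \<noteq> em g" if g: "g \<in> carrier G" for g
  proof
    assume "?b = em g"
    then have "limitin FC (\<lambda>n. em ((h \<circ> r) n)) (em g) sequentially" using lim by (rule subst)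
    then have "\<forall>\<^sub>F n in sequentially. em ((h \<circ> r) n) \<in> {em g}"
      using em_open[OF g] unfolding limitin_def by blast
    then obtain n0 where n0: "\<And>n. n \<ge> n0 \<Longrightarrow> em ((h \<circ> r) n) = em g" by (auto simp: eventually_sequentially)
    have "fd f ((h \<circ> r) n0) ((h \<circ> r) (Suc n0)) = completion_dist (carrier G) (fd f) (em ((h \<circ> r) n0)) (em ((h \<circ> r) (Suc n0)))"
      unfolding floyd_embed_def by (rule D.completion_dist_embed[OF hG hG, symmetric])
    also have "\<dots> = completion_dist (carrier G) (fd f) (em g) (em g)" using n0[of n0] n0[of "Suc n0"] by simp
    also have "\<dots> = fd f g g" unfolding floyd_embed_def by (rule D.completion_dist_embed[OF g g])
    also have "\<dots> = 0" using g by simp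
    finally have "(h \<circ> r) n0 = (h \<circ> r) (Suc n0)" using D.zero[OF hG hG] by blast
    then show False using injD[OF inj] by fastforce
  qed
  moreover have "?b \<in> CC" using limitin_topspace[OF lim] topspace_FC by simp
  ultimately have "?b \<in> bd" by (auto simp: boundary_iff)
  moreover have "range (h \<circ> r) \<subseteq> H" using h(2) by auto
  ultimately show ?thesis using lim frontier_iff[OF H(2)] by blast
qed

text \<open>\<open>collapsed_pair\<close> needs a second point over \<open>p\<close>. The stabilizer
  of a parabolic point is infinite, so its frontier contains some \<open>b\<close>, which lies over
  \<open>p\<close> by \<open>frontier_fibre\<close>; a point of the fibre is either \<open>b\<close>
  or forms a collapsed pair with it.\<close>

lemma fibre_eq_frontier:
  assumes par: "parabolic_point G X \<phi> p"
  shows "{a \<in> bd. F a = p} = FC frontier_of (em ` stabilizer G \<phi> p)"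
proof (intro subset_antisym subsetI)
  let ?H = "stabilizer G \<phi> p"
  have HG: "?H \<subseteq> carrier G" using stabilizer_in by blast
  fix a
  assume "a \<in> FC frontier_of (em ` ?H)"
  then show "a \<in> {a \<in> bd. F a = p}" using frontier_fibre[OF par] frontier_iff[OF HG] by blast
next
  let ?H = "stabilizer G \<phi> p"
  have HG: "?H \<subseteq> carrier G" using stabilizer_in by blast
  have "infinite ?H"
  proof
    assume "finite ?H"
    \<comment> \<open>With the whole space as neighbourhood, a finite stabilizer acts properly
      discontinuously at every point, and its limit set would have cardinality 0.\<close>
    then have "finite {h \<in> ?H. \<phi> h ` topspace X \<inter> topspace X \<noteq> {}}" by simp
    then have "limit_set ?H X \<phi> = {}"
      unfolding limit_set_def properly_discontinuous_at_def using openin_topspace by blast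
    then show False using par by (simp add: parabolic_point_def)
  qed
  then obtain b where b: "b \<in> FC frontier_of (em ` ?H)" using infinite_frontier[OF _ HG] by blast
  fix a assume "a \<in> {a \<in> bd. F a = p}"
  then have a: "a \<in> bd" "F a = p" by auto
  show "a \<in> FC frontier_of (em ` ?H)"
  proof (cases "a = b")
    case False
    have "b \<in> bd" "F b = p" using b frontier_fibre[OF par b] frontier_iff[OF HG] by blast+
    then show ?thesis using collapsed_pair(2)[OF a(1) _ False a(2)] by blast
  qed (use b in simp)
qed

text \<open>A collapsed pair puts a boundary point into the frontier of the stabilizer, which is
  therefore infinite, and provides a horocyclic element; together these force the limit set to be
  the single point \<open>p\<close>.\<close>

lemma injective_or_parabolic:
  assumes "a \<in> bd" "b \<in> bd" "F a = p" "F b = p" "a \<noteq> b"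
  shows "parabolic_point G X \<phi> p"
proof -
  have "infinite (stabilizer G \<phi> p)"
    using frontier_infinite[OF collapsed_pair(2)[OF assms(1,2,5,3,4)]] stabilizer_in by blast
  moreover obtain s where "s \<in> carrier G" "horocyclic p s"
    using collapsed_pair(1)[OF assms(1,2,5,3,4)] by blast
  moreover have "p \<in> topspace X" using bdry[OF assms(1)] assms(3) by simp
  ultimately show ?thesis using parabolic_if_horocyclic by blast
qed

end

theorem theoremA:
  fixes G :: "('g, 'm) monoid_scheme" and S :: "'g set"
    and X :: "'a topology" and \<phi> :: "'g \<Rightarrow> 'a \<Rightarrow> 'a"
    and lam :: real
    and V :: "'v set" and E :: "'v set set" and \<rho> :: "'g \<Rightarrow> 'v \<Rightarrow> 'v"
    and M :: "('a + 'v) topology" and \<psi> :: "'g \<Rightarrow> 'v"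
    and \<Psi> :: "(nat \<Rightarrow> 'g) set \<Rightarrow> 'a + 'v" and F\<^sub>0 :: "(nat \<Rightarrow> 'g) set \<Rightarrow> 'a"
    and f :: "nat \<Rightarrow> real" and chi :: "(nat \<Rightarrow> 'g) set \<Rightarrow> (nat \<Rightarrow> 'g) set"
    and F :: "(nat \<Rightarrow> 'g) set \<Rightarrow> 'a"
  assumes "group G"
    and "finite S" "S \<subseteq> carrier G" "generate G S = carrier G"
    and "compact_space X" "Hausdorff_space X"
    and "infinite (topspace X) \<or> card (topspace X) > 2"
    and "acts_by_homeos G X \<phi>"
    and "three_discontinuous G X \<phi>"
    and "two_cocompact G X \<phi>"
    and "0 < lam" "lam < 1"
    and "exponential_floyd_map G S X \<phi> lam V E \<rho> M \<psi> \<Psi> F\<^sub>0"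
    and "floyd_function f" "\<And>n. n \<ge> 1 \<Longrightarrow> f n \<ge> lam ^ n"
    and "extends_identity G S f (\<lambda>n. lam ^ n) chi"
    and "F = F\<^sub>0 \<circ> chi"
  shows "(\<forall>p. parabolic_point G X \<phi> p \<longrightarrow>
            {a \<in> floyd_boundary G S f. F a = p} =
            floyd_completion G S f frontier_of (floyd_embed G S f ` stabilizer G \<phi> p)) \<and>
         (\<forall>a\<in>floyd_boundary G S f. \<forall>b\<in>floyd_boundary G S f. \<forall>p\<in>topspace X.
            F a = p \<and> F b = p \<longrightarrow> a = b \<or> parabolic_point G X \<phi> p)"
proof -
  interpret A: floyd_graph_action G S X \<phi> lam V E \<rho> M \<psi> \<Psi> F\<^sub>0
    by (intro floyd_graph_action.intro cayley.intro cayley_axioms.intro floyd_graph_action_axioms.intro) fact+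
  interpret D: Metric_space "carrier G" "group_floyd_dist G S f" by (rule A.Metric_space_fd) fact
  note exp = A.exp_parts
  let ?f0 = "\<lambda>n. lam ^ n"
  have chi: "continuous_map (floyd_completion G S f) (floyd_completion G S ?f0) chi"
    and chi_embed: "\<And>g. g \<in> carrier G \<Longrightarrow> chi (floyd_embed G S f g) = floyd_embed G S ?f0 g"
    using \<open>extends_identity G S f ?f0 chi\<close> by (auto simp: extends_identity_def)
  have Psi: "continuous_map (floyd_completion G S ?f0) M \<Psi>"
    and Psi_embed: "\<And>g. g \<in> carrier G \<Longrightarrow> \<Psi> (floyd_embed G S ?f0 g) = Inr (\<psi> g)"
    and Psi_bdry: "\<And>a. a \<in> floyd_boundary G S ?f0 \<Longrightarrow> F\<^sub>0 a \<in> topspace X \<and> \<Psi> a = Inl (F\<^sub>0 a)"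
    using exp by blast+
  have cont: "continuous_map (floyd_completion G S f) M (\<Psi> \<circ> chi)"
    using chi Psi by (rule continuous_map_compose)
  have embed: "(\<Psi> \<circ> chi) (floyd_embed G S f g) = Inr (\<psi> g)" if "g \<in> carrier G" for g
    using chi_embed[OF that] Psi_embed[OF that] by simp
  \<comment> \<open>\<open>F\<^sub>0\<close> describes \<open>\<Psi>\<close> on the boundary only,
    so \<open>chi\<close> must be shown to send boundary points to boundary points. If
    \<open>chi a\<close> were in \<open>G\<close>, the vertices of \<open>s n\<close> would converge
    to an isolated vertex, and a tail of \<open>s\<close> would stay in a finite fibre of
    \<open>\<psi>\<close>.\<close>
  have bdry: "F a \<in> topspace X \<and> (\<Psi> \<circ> chi) a = Inl (F a)" if a: "a \<in> floyd_boundary G S f" for a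
  proof -
    have aC: "a \<in> cauchy_completion (carrier G) (group_floyd_dist G S f)"
      using a by (simp add: floyd_boundary_def floyd_completion_def D.topspace_completion)
    obtain s where s: "D.MCauchy s" "a = cauchy_equiv (carrier G) (group_floyd_dist G S f) `` {s}"
      using D.completion_obtain_seq[OF aC] .
    have sG: "s n \<in> carrier G" for n using s(1) by (auto simp: D.MCauchy_def)
    have lim: "limitin (floyd_completion G S f) (\<lambda>n. floyd_embed G S f (s n)) a sequentially"
      using D.Cauchy_limit_class[OF s(1)] s(2) by (simp add: floyd_completion_def floyd_embed_def)
    have "chi a \<noteq> floyd_embed G S ?f0 g" if g: "g \<in> carrier G" for g
    proof
      assume "chi a = floyd_embed G S ?f0 g"
      then have "limitin M (\<lambda>n. Inr (\<psi> (s n))) (Inr (\<psi> g)) sequentially"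
        using continuous_map_limit[OF cont lim] embed[OF sG] Psi_embed[OF g] by (simp add: o_def)
      then have "\<forall>\<^sub>F n in sequentially. Inr (\<psi> (s n)) \<in> {Inr (\<psi> g) :: 'a + 'v}"
        using A.vx_open[OF g] unfolding limitin_def by blast
      moreover have "\<forall>\<^sub>F n in sequentially. s n \<notin> {h \<in> carrier G. \<psi> h = \<psi> g}"
        by (rule D.completion_limit_leaves_finite[OF lim[unfolded floyd_completion_def floyd_embed_def] sG _ A.finite_fiber[OF g]])
           (use a in \<open>simp add: floyd_boundary_def floyd_embed_def\<close>)
      ultimately have "\<forall>\<^sub>F n in sequentially. False" by eventually_elim (use sG in auto)
      then show False by simp
    qed
    moreover have "chi a \<in> topspace (floyd_completion G S ?f0)"
      using a continuous_map_image_subset_topspace[OF chi] by (auto simp: floyd_boundary_def)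
    ultimately have "chi a \<in> floyd_boundary G S ?f0" by (auto simp: floyd_boundary_def)
    then show ?thesis using Psi_bdry[of "chi a"] \<open>F = F\<^sub>0 \<circ> chi\<close> by simp
  qed
  interpret B: floyd_boundary_map G S X \<phi> lam V E \<rho> M \<psi> \<Psi> F\<^sub>0 f "\<Psi> \<circ> chi" F
    by unfold_locales (fact | rule cont embed bdry)+
  show ?thesis using B.fibre_eq_frontier B.injective_or_parabolic by blast
qed

end
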